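(* Let $X(\mathbb{R}^n)$ be a Banach function space on $\mathbb{R}^n$ such that: (i) $X(\mathbb{R}^n)$ has the Fatou property; (ii) the norm of $X(\mathbb{R}^n)$ is absolutely continuous; (iii) $X(\mathbb{R}^n)$ satisfies the strong Muckenhoupt condition on $\mathbb{R}^n$. Then $C_c^\infty(\mathbb{R}^n)$ is dense in $W^1_X(\mathbb{R}^n)$.
   Context: Write $\Omega=\mathbb{R}^n$. $L^0(\Omega)$ denotes the Lebesgue measurable functions on $\Omega$ (identified if equal a.e.). Cubes have sides parallel to the coordinate axes. Banach function space: a vector subspace $X(\Omega)\subseteq L^0(\Omega)$ equipped with a norm $\|\cdot\|_{X(\Omega)}$, complete in this norm, and satisfying: (ideal property) if $f\in X(\Omega)$, $g\in L^0(\Omega)$ and $|g|\le|f|$, then $g\in X(\Omega)$ and $\|g\|_{X(\Omega)}\le\|f\|_{X(\Omega)}$; (saturation property) for every measurable $E\subseteq\Omega$ of positive measure there is a measurable $F\subseteq E$ of positive measure with $\chi_F\in X(\Omega)$. Associate space: $X'(\Omega)$ is the set of $g\in L^0(\Omega)$ with $fg\in L^1(\Omega)$ for all $f\in X(\Omega)$, with $\|g\|_{X'(\Omega)}=\sup\{\int_\Omega|fg|\,dx: f\in X(\Omega),\ \|f\|_{X(\Omega)}=1\}$. Fatou property: if $0\le f_1\le f_2\le\cdots$ are in $X(\Omega)$, $\sup_k\|f_k\|_{X(\Omega)}<\infty$ and $f_k\uparrow f$ pointwise, then $f\in X(\Omega)$ and $\|f\|_{X(\Omega)}=\lim_k\|f_k\|_{X(\Omega)}$.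 Absolutely continuous norm: for every $f\in X(\Omega)$ and every sequence of measurable sets $E_1\supset E_2\supset\cdots$ in $\Omega$ with $\bigcap_k E_k=\emptyset$, $\lim_{k}\|f\chi_{E_k}\|_{X(\Omega)}=0$. Strong Muckenhoupt condition: for every cube $Q\subset\Omega$, $\chi_Q\in X(\Omega)$ and $\chi_Q\in X'(\Omega)$, and $[X(\Omega)]_{A^s(\Omega)}=\sup_{\mathcal{Q}}\|A_{\mathcal{Q}}\|<\infty$, where the supremum is over all collections $\mathcal{Q}$ of pairwise disjoint cubes contained in $\Omega$, $A_{\mathcal{Q}}f(x)=\sum_{Q\in\mathcal{Q}}\left(|Q|^{-1}\int_Q f(y)\,dy\right)\chi_Q(x)$, and $\|A_{\mathcal{Q}}\|$ is the operator norm on $X(\Omega)$. Sobolev space: $W^{1,1}_{loc}(\Omega)$ is the set of $f\in L^1_{loc}(\Omega)$ whose distributional partial derivatives $\partial_jf$, $j=1,\dots,n$, exist and lie in $L^1_{loc}(\Omega)$; $\nabla f=(\partial_1f,\dots,\partial_nf)$. $W^1_X(\Omega)$ is the set of $f\in W^{1,1}_{loc}(\Omega)$ with $f$ and all $\partial_j f$ in $X(\Omega)$, normed by $\|f\|_{W^1_X(\Omega)}=\|f\|_{X(\Omega)}+\|\nabla f\|_{X(\Omega)}$, where $\|\nabla f\|_{X(\Omega)}=\|\,|\nabla f|\,\|_{X(\Omega)}$. *)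

theory Defs
  imports "HOL-Analysis.Analysis"
begin

section \<open>Banach function spaces on \<open>\<real>\<^sup>n\<close>\<close>

text \<open>
  Elements of \<open>L\<^sup>0\<close> are represented by real-valued Lebesgue measurable functions on \<open>real ^ 'n\<close>
  rather than by classes modulo equality almost everywhere. Accordingly \<open>N\<close> vanishes exactly
  on the functions that are zero a.e., and relations between elements of \<open>L\<^sup>0\<close> are relations
  a.e. Because of the ideal property, both \<open>X\<close> and the restriction of \<open>N\<close> to \<open>X\<close> are invariant
  under changes on null sets. The values of \<open>N\<close> outside \<open>X\<close> are irrelevant.
\<close>

locale banach_function_space =
  fixes X :: "(real ^ 'n \<Rightarrow> real) set"
    and N :: "(real ^ 'n \<Rightarrow> real) \<Rightarrow> real"
  assumes measurable: "f \<in> X \<Longrightarrow> f \<in> borel_measurable lebesgue"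
    and zero: "(\<lambda>x. 0) \<in> X"
    and add: "f \<in> X \<Longrightarrow> g \<in> X \<Longrightarrow> (\<lambda>x. f x + g x) \<in> X"
    and scale: "f \<in> X \<Longrightarrow> (\<lambda>x. c * f x) \<in> X"
    and norm_nonneg: "f \<in> X \<Longrightarrow> 0 \<le> N f"
    and norm_eq_0_iff: "f \<in> X \<Longrightarrow> N f = 0 \<longleftrightarrow> (AE x in lebesgue. f x = 0)"
    and norm_triangle: "f \<in> X \<Longrightarrow> g \<in> X \<Longrightarrow> N (\<lambda>x. f x + g x) \<le> N f + N g"
    and norm_scale: "f \<in> X \<Longrightarrow> N (\<lambda>x. c * f x) = \<bar>c\<bar> * N f"
    and complete:
      "\<lbrakk>\<And>k. F k \<in> X; \<And>\<epsilon>. \<epsilon> > 0 \<Longrightarrow> \<exists>M. \<forall>j\<ge>M. \<forall>k\<ge>M. N (\<lambda>x. F j x - F k x) < \<epsilon>\<rbrakk>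
        \<Longrightarrow> \<exists>f\<in>X. (\<lambda>k. N (\<lambda>x. F k x - f x)) \<longlonglongrightarrow> 0"
    and ideal:
      "\<lbrakk>f \<in> X; g \<in> borel_measurable lebesgue; AE x in lebesgue. \<bar>g x\<bar> \<le> \<bar>f x\<bar>\<rbrakk>
        \<Longrightarrow> g \<in> X \<and> N g \<le> N f"
    and saturation:
      "\<lbrakk>E \<in> sets lebesgue; emeasure lebesgue E > 0\<rbrakk>
        \<Longrightarrow> \<exists>F\<in>sets lebesgue. F \<subseteq> E \<and> emeasure lebesgue F > 0 \<and> indicator F \<in> X"

definition associate_space :: "(real ^ 'n \<Rightarrow> real) set \<Rightarrow> (real ^ 'n \<Rightarrow> real) set" where
  "associate_space X =
    {g \<in> borel_measurable lebesgue. \<forall>f\<in>X. integrable lebesgue (\<lambda>x. f x * g x)}"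

definition fatou_property ::
    "(real ^ 'n \<Rightarrow> real) set \<Rightarrow> ((real ^ 'n \<Rightarrow> real) \<Rightarrow> real) \<Rightarrow> bool" where
  "fatou_property X N \<longleftrightarrow>
    (\<forall>F f. (\<forall>k. F k \<in> X) \<and> bdd_above (range (\<lambda>k. N (F k))) \<and>
       (AE x in lebesgue. (\<forall>k. 0 \<le> F k x \<and> F k x \<le> F (Suc k) x) \<and> (\<lambda>k. F k x) \<longlonglongrightarrow> f x)
     \<longrightarrow> f \<in> X \<and> (\<lambda>k. N (F k)) \<longlonglongrightarrow> N f)"

definition absolutely_continuous_norm ::
    "(real ^ 'n \<Rightarrow> real) set \<Rightarrow> ((real ^ 'n \<Rightarrow> real) \<Rightarrow> real) \<Rightarrow> bool" where
  "absolutely_continuous_norm X N \<longleftrightarrow>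
    (\<forall>f\<in>X. \<forall>E. range E \<subseteq> sets lebesgue \<and> decseq E \<and> (\<Inter>k. E k) = {}
       \<longrightarrow> (\<lambda>k. N (\<lambda>x. f x * indicator (E k) x)) \<longlonglongrightarrow> 0)"


section \<open>The strong Muckenhoupt condition\<close>

text \<open>
  Cubes are taken to be open. Replacing the members of a pairwise disjoint family of cubes, with
  whatever parts of their boundaries, by their interiors gives a pairwise disjoint family of open
  cubes and changes the averaging operator only on a null set, so the open cubes give the largest
  supremum among the usual conventions.
\<close>

definition cubes :: "(real ^ 'n) set set" where
  "cubes = {box a (a + (\<chi> i. l)) | a l. l > 0}"

text \<open>
  For a pairwise disjoint family at most one term of the sum is nonzero at each point, so the
  unconditional sum always exists there.
\<close>

definition averaging_op ::
    "(real ^ 'n) set set \<Rightarrow> (real ^ 'n \<Rightarrow> real) \<Rightarrow> real ^ 'n \<Rightarrow> real" where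
  "averaging_op \<Q> f x =
    (\<Sum>\<^sub>\<infinity>Q\<in>\<Q>. (1 / measure lebesgue Q * (LINT y:Q|lebesgue. f y)) * indicator Q x)"

text \<open>The operator norm is \<open>\<infinity>\<close> if the operator does not map \<open>X\<close> into itself.\<close>

definition operator_norm ::
    "(real ^ 'n \<Rightarrow> real) set \<Rightarrow> ((real ^ 'n \<Rightarrow> real) \<Rightarrow> real) \<Rightarrow>
     ((real ^ 'n \<Rightarrow> real) \<Rightarrow> (real ^ 'n \<Rightarrow> real)) \<Rightarrow> ennreal" where
  "operator_norm X N T =
    (SUP f\<in>{f \<in> X. N f \<le> 1}. if T f \<in> X then ennreal (N (T f)) else \<infinity>)"

definition strong_muckenhoupt_const ::
    "(real ^ 'n \<Rightarrow> real) set \<Rightarrow> ((real ^ 'n \<Rightarrow> real) \<Rightarrow> real) \<Rightarrow> ennreal" where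
  "strong_muckenhoupt_const X N =
    (SUP \<Q>\<in>{\<Q>. \<Q> \<subseteq> cubes \<and> disjoint \<Q>}. operator_norm X N (averaging_op \<Q>))"

definition strong_muckenhoupt ::
    "(real ^ 'n \<Rightarrow> real) set \<Rightarrow> ((real ^ 'n \<Rightarrow> real) \<Rightarrow> real) \<Rightarrow> bool" where
  "strong_muckenhoupt X N \<longleftrightarrow>
    (\<forall>Q\<in>cubes. indicator Q \<in> X \<and> indicator Q \<in> associate_space X) \<and>
    strong_muckenhoupt_const X N < \<infinity>"


section \<open>Test functions and Sobolev spaces\<close>

definition partial_deriv :: "'n \<Rightarrow> (real ^ 'n \<Rightarrow> real) \<Rightarrow> real ^ 'n \<Rightarrow> real" where
  "partial_deriv i f x = frechet_derivative f (at x) (axis i 1)"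

primrec Ck :: "nat \<Rightarrow> (real ^ 'n \<Rightarrow> real) \<Rightarrow> bool" where
  "Ck 0 f \<longleftrightarrow> continuous_on UNIV f"
| "Ck (Suc k) f \<longleftrightarrow> f differentiable_on UNIV \<and> (\<forall>i. Ck k (partial_deriv i f))"

definition test_functions :: "(real ^ 'n \<Rightarrow> real) set" where
  "test_functions = {\<phi>. (\<forall>k. Ck k \<phi>) \<and> compact (closure {x. \<phi> x \<noteq> 0})}"

definition L1_loc :: "(real ^ 'n \<Rightarrow> real) set" where
  "L1_loc = {f \<in> borel_measurable lebesgue. \<forall>K. compact K \<longrightarrow> set_integrable lebesgue K f}"

definition has_weak_partial ::
    "(real ^ 'n \<Rightarrow> real) \<Rightarrow> 'n \<Rightarrow> (real ^ 'n \<Rightarrow> real) \<Rightarrow> bool" where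
  "has_weak_partial f i g \<longleftrightarrow> g \<in> L1_loc \<and>
    (\<forall>\<phi>\<in>test_functions.
      (LINT x|lebesgue. f x * partial_deriv i \<phi> x) = - (LINT x|lebesgue. g x * \<phi> x))"

definition W11_loc :: "(real ^ 'n \<Rightarrow> real) set" where
  "W11_loc = {f \<in> L1_loc. \<forall>i. \<exists>g. has_weak_partial f i g}"

text \<open>A representative of the distributional derivative, which is unique up to null sets.\<close>

definition weak_partial :: "'n \<Rightarrow> (real ^ 'n \<Rightarrow> real) \<Rightarrow> real ^ 'n \<Rightarrow> real" where
  "weak_partial i f = (SOME g. has_weak_partial f i g)"

definition weak_gradient :: "(real ^ 'n \<Rightarrow> real) \<Rightarrow> real ^ 'n \<Rightarrow> real ^ 'n" where
  "weak_gradient f x = (\<chi> i. weak_partial i f x)"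

definition sobolev_space :: "(real ^ 'n \<Rightarrow> real) set \<Rightarrow> (real ^ 'n \<Rightarrow> real) set" where
  "sobolev_space X = {f \<in> W11_loc. f \<in> X \<and> (\<forall>i. weak_partial i f \<in> X)}"

definition sobolev_norm ::
    "((real ^ 'n \<Rightarrow> real) \<Rightarrow> real) \<Rightarrow> (real ^ 'n \<Rightarrow> real) \<Rightarrow> real" where
  "sobolev_norm N f = N f + N (\<lambda>x. norm (weak_gradient f x))"

end

theory Submission
  imports Defs
begin

text \<open>
  Let \<open>\<phi>\<^sub>e\<close> be a smooth mollifier supported in the ball of radius \<open>e\<close>. At every point of a grid
  cell of mesh \<open>e\<close>, the convolution \<open>\<bar>\<phi>\<^sub>e * f\<bar>\<close> is at most a constant times the average of \<open>\<bar>f\<bar>\<close>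
  over the cell dilated by \<open>3\<close>. The dilated cells split into \<open>3\<^sup>n\<close> disjoint families, so the strong
  Muckenhoupt condition bounds \<open>f \<mapsto> \<phi>\<^sub>e * f\<close> on \<open>X\<close> uniformly in \<open>e\<close>. Absolute continuity of the norm
  gives dominated convergence and thereby density of the continuous functions with compact support,
  for which \<open>\<phi>\<^sub>e * f\<close> converges uniformly; hence \<open>\<phi>\<^sub>e * f \<rightarrow> f\<close> in \<open>X\<close> for all \<open>f\<close>. As convolution
  commutes with weak derivatives, \<open>\<eta> (\<phi>\<^sub>e * f)\<close> with a smooth cutoff \<open>\<eta>\<close> approximates \<open>f\<close> in the Sobolev
  norm; the error of the cutoff lives outside a large ball and vanishes by absolute continuity.
\<close>

section \<open>Smooth functions and test functions\<close>

text \<open>The classical route to convergence of mollifications, Minkowski's inequality combined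
  with continuity of translations, is closed here: the norm of \<open>X\<close> is not translation
  invariant, and translations need not even map \<open>X\<close> into itself. Domination by averages
  over cubes takes their place.

  The requirements on single cubes have tasks of their own. Indicators in the associate space make
  the members of \<open>X\<close> locally integrable, so that the convolution is defined at all;
  indicators in \<open>X\<close> turn uniform estimates on a ball into norm estimates.

  Mollifying before cutting off means that the product rule is only ever applied to smooth
  functions. The gradient of the cutoff must then be bounded independently of the radius, because
  its product with the mollified function is controlled through the tail of that function alone.

  As \<open>weak_partial\<close> is a choice among representatives, no concrete derivative can stand
  for it before weak derivatives are known to be unique almost everywhere; this is the purpose of
  the fundamental lemma.\<close>

lemma partial_deriv_eq:
  assumes "(f has_derivative D) (at x)"
  shows "partial_deriv i f x = D (axis i 1)"
  by (simp add: partial_deriv_def frechet_derivative_at[OF assms, symmetric])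

lemma linear_eq_sum_axis:
  fixes D :: "real ^ 'n \<Rightarrow> real"
  assumes "linear D"
  shows "D h = (\<Sum>i\<in>UNIV. h $ i * D (axis i 1))"
proof -
  have "D h = D (\<Sum>i\<in>UNIV. (h $ i) *\<^sub>R axis i 1)"
    using basis_expansion[of h] by (simp add: scalar_mult_eq_scaleR)
  then show ?thesis
    by (simp add: linear_sum[OF assms] linear_scale[OF assms])
qed

lemma has_derivative_partial_deriv:
  fixes f :: "real ^ 'n \<Rightarrow> real"
  assumes "f differentiable at x"
  shows "(f has_derivative (\<lambda>h. \<Sum>i\<in>UNIV. h $ i * partial_deriv i f x)) (at x)"
proof -
  obtain D where D: "(f has_derivative D) (at x)"
    using assms unfolding differentiable_def by blast
  have "D = (\<lambda>h. \<Sum>i\<in>UNIV. h $ i * partial_deriv i f x)"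
    unfolding partial_deriv_eq[OF D]
    by (rule ext) (rule linear_eq_sum_axis[OF has_derivative_linear[OF D]])
  then show ?thesis
    using D by simp
qed

lemma differentiable_on_UNIV:
  "f differentiable_on UNIV \<longleftrightarrow> (\<forall>x. f differentiable at x)"
  by (simp add: differentiable_on_def)

text \<open>The recursion demands differentiability at each level and continuity only at the bottom,
  so descent is an induction that ends with differentiable functions being continuous. The product
  rule needs it, since undifferentiated factors occur there.\<close>

lemma Ck_SucD: "Ck (Suc k) f \<Longrightarrow> Ck k f"
proof (induction k arbitrary: f)
  case 0
  then show ?case
    by (simp add: differentiable_imp_continuous_on)
next
  case (Suc k)
  have "f differentiable_on UNIV" "Ck (Suc k) (partial_deriv i f)" for i
    using Suc.prems by (simp_all only: Ck.simps simp_thms)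
  then show ?case
    using Suc.IH by (intro Ck.simps(2)[THEN iffD2] conjI allI) blast+
qed

lemma partial_deriv_const: "partial_deriv i (\<lambda>x. c) = (\<lambda>x. 0)"
  by (rule ext, rule partial_deriv_eq[OF has_derivative_const, THEN trans]) simp

lemma Ck_const: "Ck k (\<lambda>x. c)"
  by (induction k arbitrary: c) (simp_all add: partial_deriv_const)

lemma partial_deriv_add:
  fixes f g :: "real ^ 'n \<Rightarrow> real"
  assumes "f differentiable at x" "g differentiable at x"
  shows "partial_deriv i (\<lambda>x. f x + g x) x = partial_deriv i f x + partial_deriv i g x"
proof -
  obtain D E where *: "(f has_derivative D) (at x)" "(g has_derivative E) (at x)"
    using assms unfolding differentiable_def by blast
  show ?thesis
    by (simp add: partial_deriv_eq[OF has_derivative_add[OF *]] partial_deriv_eq[OF *(1)]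
        partial_deriv_eq[OF *(2)])
qed

lemma partial_deriv_mult:
  fixes f g :: "real ^ 'n \<Rightarrow> real"
  assumes "f differentiable at x" "g differentiable at x"
  shows "partial_deriv i (\<lambda>x. f x * g x) x = f x * partial_deriv i g x + partial_deriv i f x * g x"
proof -
  obtain D E where *: "(f has_derivative D) (at x)" "(g has_derivative E) (at x)"
    using assms unfolding differentiable_def by blast
  show ?thesis
    by (simp add: partial_deriv_eq[OF has_derivative_mult[OF *]] partial_deriv_eq[OF *(1)]
        partial_deriv_eq[OF *(2)])
qed

lemma Ck_add: "Ck k f \<Longrightarrow> Ck k g \<Longrightarrow> Ck k (\<lambda>x. f x + g x)"
proof (induction k arbitrary: f g)
  case 0
  then show ?case by (simp add: continuous_on_add)
next
  case (Suc k)
  then have d: "f differentiable at x" "g differentiable at x" for x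
    by (simp_all add: differentiable_on_UNIV)
  have "partial_deriv i (\<lambda>x. f x + g x) = (\<lambda>x. partial_deriv i f x + partial_deriv i g x)" for i
    by (rule ext) (rule partial_deriv_add[OF d])
  then show ?case
    using Suc d by (simp add: differentiable_on_UNIV)
qed

lemma Ck_mult: "Ck k f \<Longrightarrow> Ck k g \<Longrightarrow> Ck k (\<lambda>x. f x * g x)"
proof (induction k arbitrary: f g)
  case 0
  then show ?case by (simp add: continuous_on_mult)
next
  case (Suc k)
  then have d: "f differentiable at x" "g differentiable at x" for x
    by (simp_all add: differentiable_on_UNIV)
  have "partial_deriv i (\<lambda>x. f x * g x) =
      (\<lambda>x. f x * partial_deriv i g x + partial_deriv i f x * g x)" for i
    by (rule ext) (rule partial_deriv_mult[OF d])
  moreover have "Ck k f" "Ck k g" "\<And>i. Ck k (partial_deriv i f)" "\<And>i. Ck k (partial_deriv i g)"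
    using Suc.prems Ck_SucD by auto
  ultimately show ?case
    using Suc.IH d by (simp add: differentiable_on_UNIV Ck_add)
qed

text \<open>Maps \<open>a + c *\<^sub>R x\<close> cover all substitutions of the proof: translation
  for \<open>c = 1\<close>, reflection about a point for \<open>c = -1\<close>, and the scaling of
  the mollifier for \<open>c = 1 / e\<close>.\<close>

lemma partial_deriv_affine:
  fixes f :: "real ^ 'n \<Rightarrow> real"
  assumes "f differentiable at (a + c *\<^sub>R x)"
  shows "((\<lambda>x. f (a + c *\<^sub>R x)) differentiable at x) \<and>
    partial_deriv i (\<lambda>x. f (a + c *\<^sub>R x)) x = c * partial_deriv i f (a + c *\<^sub>R x)"
proof -
  obtain D where D: "(f has_derivative D) (at (a + c *\<^sub>R x))"
    using assms unfolding differentiable_def by blast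
  have *: "((\<lambda>x. f (a + c *\<^sub>R x)) has_derivative (\<lambda>h. D (c *\<^sub>R h))) (at x)"
    by (rule has_derivative_compose[where f = "\<lambda>x. a + c *\<^sub>R x", OF _ D]) (auto intro!: derivative_eq_intros)
  then show ?thesis
    using linear_scale[OF has_derivative_linear[OF D]]
    by (auto simp: partial_deriv_eq[OF *] partial_deriv_eq[OF D] differentiable_def)
qed

lemma Ck_affine:
  fixes f :: "real ^ 'n \<Rightarrow> real"
  shows "Ck k f \<Longrightarrow> Ck k (\<lambda>x. f (a + c *\<^sub>R x))"
proof (induction k arbitrary: f)
  case 0
  then have "continuous_on UNIV f" by simp
  then have "continuous_on UNIV (\<lambda>x. f (a + c *\<^sub>R x))"
    by (rule continuous_on_compose2) (auto intro!: continuous_intros)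
  then show ?case by simp
next
  case (Suc k)
  then have d: "f differentiable at x" for x
    by (simp add: differentiable_on_UNIV)
  have "partial_deriv i (\<lambda>x. f (a + c *\<^sub>R x)) = (\<lambda>x. c * partial_deriv i f (a + c *\<^sub>R x))" for i
    using partial_deriv_affine[OF d] by (intro ext) blast
  moreover have "Ck k (\<lambda>x. partial_deriv i f (a + c *\<^sub>R x))" for i
    using Suc by simp
  ultimately show ?case
    using partial_deriv_affine[OF d] by (simp add: differentiable_on_UNIV Ck_mult Ck_const)
qed

lemma Ck_coord:
  "Ck k (\<lambda>x :: real ^ 'n. x $ i)"
proof (cases k)
  case 0
  then show ?thesis by (auto intro!: continuous_intros)
next
  case (Suc m)
  have *: "((\<lambda>x :: real ^ 'n. x $ i) has_derivative (\<lambda>h. h $ i)) (at x)" for x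
    by (rule bounded_linear_imp_has_derivative[OF bounded_linear_vec_nth])
  have "partial_deriv j (\<lambda>x :: real ^ 'n. x $ i) = (\<lambda>x. axis j 1 $ i)" for j
    by (rule ext) (rule partial_deriv_eq[OF *])
  then show ?thesis
    using * by (auto simp: Suc differentiable_on_UNIV differentiable_def Ck_const)
qed

text \<open>The family of all \<open>exp (- 1 / t) / t ^ k\<close> is closed under differentiation up to linear
  combinations, so the smoothness of its members follows without computing any higher derivative.\<close>

definition flat_exp :: "nat \<Rightarrow> real \<Rightarrow> real" where
  "flat_exp k t = (if t > 0 then exp (- 1 / t) / t ^ k else 0)"

text \<open>From the right, s = 1 / t turns the expression into s^k / exp s, and the exponential
  wins; from the left the function is zero.\<close>

lemma flat_exp_tendsto_0: "(flat_exp k \<longlongrightarrow> 0) (at 0)"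
proof -
  have "((\<lambda>t. inverse t ^ k / exp (inverse t)) \<longlongrightarrow> (0::real)) (at_right 0)"
    by (rule filterlim_compose[OF tendsto_power_div_exp_0 filterlim_inverse_at_top_right])
  then have r: "(flat_exp k \<longlongrightarrow> 0) (at_right 0)"
    by (rule Lim_transform_eventually)
      (auto simp: eventually_at_filter flat_exp_def exp_minus field_simps)
  have l: "(flat_exp k \<longlongrightarrow> 0) (at_left 0)"
    by (rule Lim_transform_eventually[OF tendsto_const])
      (auto simp: eventually_at_filter flat_exp_def)
  show ?thesis
    using l r by (simp add: filterlim_split_at)
qed

lemma flat_exp_deriv:
  "(flat_exp k has_real_derivative flat_exp (k + 2) t - real k * flat_exp (k + 1) t) (at t)"
proof -
  consider "t > 0" | "t < 0" | "t = 0" by linarith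
  then show ?thesis
  proof cases
    case 1
    have "((\<lambda>t. exp (- 1 / t) / t ^ k) has_real_derivative
        flat_exp (k + 2) t - real k * flat_exp (k + 1) t) (at t)"
    proof (rule DERIV_cong[OF DERIV_divide[OF _ DERIV_pow]])
      show "((\<lambda>t. exp (- 1 / t)) has_real_derivative exp (- 1 / t) / t ^ 2) (at t)"
        using 1 by (auto intro!: derivative_eq_intros simp: power2_eq_square)
      show "(exp (- 1 / t) / t ^ 2 * t ^ k - exp (- 1 / t) * (real k * t ^ (k - Suc 0))) / (t ^ k * t ^ k) =
          flat_exp (k + 2) t - real k * flat_exp (k + 1) t"
        \<comment> \<open>For \<open>k = 0\<close> the exponent \<open>k - Suc 0\<close> is
          truncated, so this case is checked apart.\<close>
        using 1 by (cases k) (simp_all add: flat_exp_def field_simps power2_eq_square)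
    qed (use 1 in simp)
    moreover have "\<forall>\<^sub>F x in nhds t. (exp (- 1 / x) / x ^ k) = flat_exp k x"
      using eventually_nhds_in_open[of "{0<..}" t] 1
      by (auto elim!: eventually_mono simp: flat_exp_def)
    ultimately show ?thesis
      by (subst (asm) DERIV_cong_ev) auto
  next
    case 2
    have "\<forall>\<^sub>F x in nhds t. 0 = flat_exp k x"
      using eventually_nhds_in_open[of "{..<0}" t] 2
      by (auto elim!: eventually_mono simp: flat_exp_def)
    moreover have "((\<lambda>t. 0) has_real_derivative
        flat_exp (k + 2) t - real k * flat_exp (k + 1) t) (at t)"
      using 2 by (simp add: flat_exp_def)
    ultimately show ?thesis
      by (subst (asm) DERIV_cong_ev) auto
  next
    case 3
    \<comment> \<open>The difference quotient at 0 is again a member of the family, with index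
      \<open>Suc k\<close>.\<close>
    have "((\<lambda>h. flat_exp k h / h) \<longlongrightarrow> 0) (at 0)"
      by (rule Lim_transform_eventually[OF flat_exp_tendsto_0[of "Suc k"]])
        (auto simp: eventually_at_filter flat_exp_def)
    then show ?thesis
      using 3 by (simp add: DERIV_def flat_exp_def)
  qed
qed

text \<open>The inner function is a polynomial, so no singularity arises at the origin, as it would
  with the norm itself. A partial derivative multiplies by a coordinate and raises the index to
  \<open>k + 1\<close> and \<open>k + 2\<close>, which is why the induction generalises over
  \<open>k\<close>.\<close>

lemma Ck_flat_exp:
  "Ck m (\<lambda>x :: real ^ 'n. flat_exp k (1 - x \<bullet> x))"
proof (induction m arbitrary: k)
  case 0
  have "continuous_on UNIV (flat_exp k)"
    using DERIV_isCont[OF flat_exp_deriv] by (simp add: continuous_on_eq_continuous_at)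
  then have "continuous_on UNIV (\<lambda>x :: real ^ 'n. flat_exp k (1 - x \<bullet> x))"
    by (rule continuous_on_compose2) (auto intro!: continuous_intros)
  then show ?case by simp
next
  case (Suc m)
  define D where "D t = flat_exp (k + 2) t - real k * flat_exp (k + 1) t" for t
  have *: "((\<lambda>x :: real ^ 'n. flat_exp k (1 - x \<bullet> x)) has_derivative
      (\<lambda>h. (- (2 * (x \<bullet> h))) * D (1 - x \<bullet> x))) (at x)" for x
    unfolding D_def
    by (rule has_derivative_compose[OF _ flat_exp_deriv[THEN has_field_derivative_imp_has_derivative], THEN has_derivative_eq_rhs])
      (auto intro!: derivative_eq_intros simp: inner_commute fun_eq_iff)
  have p: "partial_deriv i (\<lambda>x :: real ^ 'n. flat_exp k (1 - x \<bullet> x)) =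
      (\<lambda>x. ((- 2) * x $ i) * (flat_exp (k + 2) (1 - x \<bullet> x) + (- real k) * flat_exp (k + 1) (1 - x \<bullet> x)))" for i
    by (rule ext) (simp add: partial_deriv_eq[OF *] D_def inner_axis)
  show ?case
    unfolding Ck.simps p
  proof (intro conjI allI Ck_mult Ck_add Ck_const Ck_coord Suc.IH)
    show "(\<lambda>x :: real ^ 'n. flat_exp k (1 - x \<bullet> x)) differentiable_on UNIV"
      using * by (auto simp: differentiable_on_UNIV differentiable_def)
  qed
qed

section \<open>Test functions and their closure properties\<close>

lemma test_functions_iff:
  "\<phi> \<in> test_functions \<longleftrightarrow> (\<forall>k. Ck k \<phi>) \<and> bounded {x. \<phi> x \<noteq> 0}"
  by (simp add: test_functions_def)

lemma test_functionsD:
  assumes "\<phi> \<in> test_functions"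
  shows "Ck k \<phi>" "bounded {x. \<phi> x \<noteq> 0}" "continuous_on UNIV \<phi>" "\<phi> differentiable at x"
proof -
  have *: "Ck k \<phi>" "bounded {x. \<phi> x \<noteq> 0}" for k
    using assms by (auto simp: test_functions_iff)
  then show "Ck k \<phi>" "bounded {x. \<phi> x \<noteq> 0}" by auto
  show "continuous_on UNIV \<phi>" using *(1)[of 0] by simp
  show "\<phi> differentiable at x" using *(1)[of 1] by (simp add: differentiable_on_UNIV)
qed

text \<open>With \<open>c = 0\<close> this confines derivatives to the support; with
  \<open>c = 1\<close> it makes the gradient of a cutoff vanish on its plateau.\<close>

lemma partial_deriv_locally_const:
  assumes "open S" "x \<in> S" "\<And>y. y \<in> S \<Longrightarrow> f y = c"
  shows "partial_deriv i f x = 0"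
proof -
  have "(f has_derivative (\<lambda>h. 0)) (at x)"
    by (rule has_derivative_transform_within_open[OF has_derivative_const[of c] assms(1,2)])
      (simp add: assms(3))
  from partial_deriv_eq[OF this] show ?thesis .
qed

lemma partial_deriv_test_functions:
  assumes "\<phi> \<in> test_functions"
  shows "partial_deriv i \<phi> \<in> test_functions"
proof -
  have "Ck k (partial_deriv i \<phi>)" for k
    using test_functionsD(1)[OF assms, of "Suc k"] by simp
  moreover have "{x. partial_deriv i \<phi> x \<noteq> 0} \<subseteq> closure {x. \<phi> x \<noteq> 0}"
  proof (rule ccontr)
    assume "\<not> ?thesis"
    then obtain x where x: "partial_deriv i \<phi> x \<noteq> 0" "x \<in> - closure {x. \<phi> x \<noteq> 0}" by auto
    have "partial_deriv i \<phi> x = 0"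
      using closure_subset[of "{x. \<phi> x \<noteq> 0}"]
      by (intro partial_deriv_locally_const[OF _ x(2), of \<phi> 0]) auto
    with x show False by simp
  qed
  then have "bounded {x. partial_deriv i \<phi> x \<noteq> 0}"
    using test_functionsD(2)[OF assms] bounded_closure bounded_subset by blast
  ultimately show ?thesis by (simp add: test_functions_iff)
qed

lemma test_functions_affine:
  fixes \<phi> :: "real ^ 'n \<Rightarrow> real"
  assumes "\<phi> \<in> test_functions" "c \<noteq> 0"
  shows "(\<lambda>x. \<phi> (a + c *\<^sub>R x)) \<in> test_functions"
proof -
  have "{x. \<phi> (a + c *\<^sub>R x) \<noteq> 0} \<subseteq> (\<lambda>y. (1 / c) *\<^sub>R (y + (- a))) ` {x. \<phi> x \<noteq> 0}"
  proof
    fix x assume "x \<in> {x. \<phi> (a + c *\<^sub>R x) \<noteq> 0}"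
    then show "x \<in> (\<lambda>y. (1 / c) *\<^sub>R (y + (- a))) ` {x. \<phi> x \<noteq> 0}"
      using assms(2) by (intro image_eqI[of _ _ "a + c *\<^sub>R x"]) auto
  qed
  moreover have "bounded ((\<lambda>y. (1 / c) *\<^sub>R (y + (- a))) ` {x. \<phi> x \<noteq> 0})"
    using bounded_scaling[OF bounded_translation[OF test_functionsD(2)[OF assms(1)], of "-a"], of "1/c"]
    by (simp add: image_image add.commute)
  ultimately show ?thesis
    using bounded_subset test_functionsD(1)[OF assms(1)] by (auto simp: test_functions_iff Ck_affine)
qed

text \<open>Only one factor needs bounded support. A cutoff thus turns a mollified function, which
  is merely smooth, into a test function.\<close>

lemma test_functions_mult:
  assumes "\<phi> \<in> test_functions" "\<And>k. Ck k f"
  shows "(\<lambda>x. \<phi> x * f x) \<in> test_functions"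
  using assms bounded_subset[of "{x. \<phi> x \<noteq> 0}" "{x. \<phi> x * f x \<noteq> 0}"]
  by (auto simp: test_functions_iff Ck_mult)

section \<open>Integration by parts and convolution\<close>

lemma continuous_imp_measurable_lebesgue:
  fixes f :: "real ^ 'n \<Rightarrow> real"
  assumes "continuous_on UNIV f"
  shows "f \<in> borel_measurable lebesgue"
  using borel_measurable_continuous_onI[OF assms] by (simp add: measurable_completion)

lemma continuous_bounded_supportE:
  fixes g :: "real ^ 'n \<Rightarrow> real"
  assumes "continuous_on UNIV g" "bounded {x. g x \<noteq> 0}"
  obtains M R where "M \<ge> 0" "\<And>x. \<bar>g x\<bar> \<le> M" "R > 0" "\<And>x. norm x > R \<Longrightarrow> g x = 0"
proof -
  obtain R where R: "R > 0" "\<And>x. g x \<noteq> 0 \<Longrightarrow> norm x \<le> R"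
    using assms(2) unfolding bounded_pos by auto
  have "compact (g ` cball 0 R)"
    using assms(1) by (intro compact_continuous_image) (auto intro: continuous_on_subset)
  then have "bounded (g ` cball 0 R)"
    by (rule compact_imp_bounded)
  then obtain M where M: "M > 0" "\<And>x. x \<in> cball 0 R \<Longrightarrow> \<bar>g x\<bar> \<le> M"
    unfolding bounded_pos by auto
  have "\<bar>g x\<bar> \<le> M" for x
    using M R(2)[of x] by (cases "g x = 0") auto
  then show thesis
    using that[of M R] M(1) R by force
qed

lemma uniformly_continuous_bounded_support:
  fixes g :: "real ^ 'n \<Rightarrow> real"
  assumes "continuous_on UNIV g" "bounded {x. g x \<noteq> 0}" "e > 0"
  obtains d where "d > 0" "\<And>x y. dist x y < d \<Longrightarrow> \<bar>g x - g y\<bar> < e"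
proof -
  obtain M R where R: "R > 0" "\<And>x. norm x > R \<Longrightarrow> g x = 0"
    using continuous_bounded_supportE[OF assms(1,2)] by metis
  \<comment> \<open>The margin 1 matters: two points at distance below 1 lie either both in the
    enlarged ball or both outside the ball of radius \<open>R\<close>, where \<open>g\<close>
    vanishes.\<close>
  have "uniformly_continuous_on (cball 0 (R + 1)) g"
    using assms(1) by (intro compact_uniformly_continuous) (auto intro: continuous_on_subset)
  then obtain d where d: "d > 0"
    "\<And>x y. x \<in> cball 0 (R + 1) \<Longrightarrow> y \<in> cball 0 (R + 1) \<Longrightarrow> dist x y < d \<Longrightarrow> \<bar>g x - g y\<bar> < e"
    using assms(3) unfolding uniformly_continuous_on_def dist_real_def by metis
  have "\<bar>g x - g y\<bar> < e" if "dist x y < min d 1" for x y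
  proof (cases "norm x \<le> R + 1 \<and> norm y \<le> R + 1")
    case True
    then show ?thesis using d(2)[of x y] that by auto
  next
    case False
    moreover have "\<bar>norm x - norm y\<bar> < 1"
      using norm_triangle_ineq3[of x y] that by (auto simp: dist_norm)
    ultimately have "norm x > R" "norm y > R" by linarith+
    then show ?thesis using R assms(3) by simp
  qed
  then show thesis using that[of "min d 1"] d(1) by simp
qed

lemma L1_locD: "f \<in> L1_loc \<Longrightarrow> f \<in> borel_measurable lebesgue"
  and L1_loc_set_integrable: "f \<in> L1_loc \<Longrightarrow> compact K \<Longrightarrow> set_integrable lebesgue K f"
  by (auto simp: L1_loc_def)

lemma continuous_imp_L1_loc:
  fixes f :: "real ^ 'n \<Rightarrow> real"
  assumes "continuous_on UNIV f"
  shows "f \<in> L1_loc"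
proof -
  have "set_integrable lebesgue K f" if "compact K" for K
  proof -
    have "integrable lborel (\<lambda>x. indicator K x *\<^sub>R f x)"
      using borel_integrable_compact[OF that, of f] assms continuous_on_subset by blast
    then show ?thesis
      unfolding set_integrable_def by (subst integrable_completion) auto
  qed
  then show ?thesis
    using continuous_imp_measurable_lebesgue[OF assms] by (simp add: L1_loc_def)
qed

lemma L1_loc_add:
  assumes "f \<in> L1_loc" "g \<in> L1_loc"
  shows "(\<lambda>x. f x + g x) \<in> L1_loc"
  using assms unfolding L1_loc_def by (auto intro: set_integral_add)

lemma L1_loc_uminus:
  assumes "f \<in> L1_loc"
  shows "(\<lambda>x. - f x) \<in> L1_loc"
  using assms unfolding L1_loc_def by (auto simp: set_integrable_def)

lemma L1_loc_diff:
  assumes "f \<in> L1_loc" "g \<in> L1_loc"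
  shows "(\<lambda>x. f x - g x) \<in> L1_loc"
  using L1_loc_add[OF assms(1) L1_loc_uminus[OF assms(2)]] by simp

text \<open>This is the common estimate behind the error terms below: a uniformly small factor
  supported in a fixed compact set makes the integral against a locally integrable function
  small.\<close>

lemma L1_loc_mult_bounded:
  assumes f: "f \<in> L1_loc" and u: "u \<in> borel_measurable lebesgue" "\<And>x. \<bar>u x\<bar> \<le> e"
    and K: "compact K" "\<And>x. x \<notin> K \<Longrightarrow> u x = 0"
  shows "integrable lebesgue (\<lambda>x. u x * f x)"
    and "\<bar>LINT x|lebesgue. u x * f x\<bar> \<le> e * (LINT x:K|lebesgue. \<bar>f x\<bar>)"
proof -
  have [measurable]: "f \<in> borel_measurable lebesgue"
    using f by (rule L1_locD)
  note [measurable] = u(1)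
  have e: "0 \<le> e" using u(2)[of undefined] by linarith
  have I: "integrable lebesgue (\<lambda>x. e * (indicator K x *\<^sub>R \<bar>f x\<bar>))"
    using set_integrable_abs[OF L1_loc_set_integrable[OF f K(1)]] by (simp add: set_integrable_def)
  have le: "\<bar>u x * f x\<bar> \<le> e * (indicator K x *\<^sub>R \<bar>f x\<bar>)" for x
    using u(2)[of x] K(2)[of x] by (cases "x \<in> K") (auto simp: abs_mult intro: mult_right_mono)
  show int: "integrable lebesgue (\<lambda>x. u x * f x)"
    by (rule Bochner_Integration.integrable_bound[OF I]) (use le order_trans[OF le abs_ge_self] in auto)
  have "\<bar>LINT x|lebesgue. u x * f x\<bar> \<le> (LINT x|lebesgue. e * (indicator K x *\<^sub>R \<bar>f x\<bar>))"
    by (rule order_trans[OF integral_abs_bound]) (intro integral_mono integrable_abs int I le)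
  then show "\<bar>LINT x|lebesgue. u x * f x\<bar> \<le> e * (LINT x:K|lebesgue. \<bar>f x\<bar>)"
    by (simp add: set_lebesgue_integral_def)
qed

lemma L1_loc_mult_continuous:
  fixes g :: "real ^ 'n \<Rightarrow> real"
  assumes "f \<in> L1_loc" "continuous_on UNIV g" "bounded {x. g x \<noteq> 0}"
  shows "integrable lebesgue (\<lambda>x. g x * f x)"
proof -
  obtain M R where "\<And>x. \<bar>g x\<bar> \<le> M" "\<And>x. norm x > R \<Longrightarrow> g x = 0"
    using continuous_bounded_supportE[OF assms(2,3)] by metis
  then show ?thesis
    by (intro L1_loc_mult_bounded(1)[OF assms(1) continuous_imp_measurable_lebesgue[OF assms(2)], of M "cball 0 R"])
      (auto simp: not_le)
qed

lemma integrable_continuous_bounded_support: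
  fixes g :: "real ^ 'n \<Rightarrow> real"
  assumes "continuous_on UNIV g" "bounded {x. g x \<noteq> 0}"
  shows "integrable lebesgue g"
  using L1_loc_mult_continuous[OF continuous_imp_L1_loc[of "\<lambda>_. 1"] assms] by simp

text \<open>Continuity makes \<open>g\<close> Borel measurable, so the substitution can be carried
  out for \<open>lborel\<close> and transferred to its completion. The factor is the Jacobian of a
  dilation.\<close>

lemma integral_lebesgue_affine:
  fixes g :: "real ^ 'n \<Rightarrow> real"
  assumes "continuous_on UNIV g" "c \<noteq> 0"
  shows "\<bar>c\<bar> ^ CARD('n) * (LINT x|lebesgue. g (t + c *\<^sub>R x)) = (LINT x|lebesgue. g x)"
proof -
  have [measurable]: "g \<in> borel_measurable borel"
    using assms(1) by (rule borel_measurable_continuous_onI)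
  have "integral\<^sup>L lborel g =
      integral\<^sup>L (density (distr lborel borel (\<lambda>x. t + c *\<^sub>R x)) (\<lambda>_. ennreal (\<bar>c\<bar> ^ CARD('n)))) g"
    using lborel_affine[OF assms(2), of t, symmetric] by simp
  also have "\<dots> = \<bar>c\<bar> ^ CARD('n) * (LINT x|lborel. g (t + c *\<^sub>R x))"
    by (simp add: integral_density integral_distr)
  finally show ?thesis
    by (simp add: integral_completion)
qed

text \<open>The partial derivatives are uniformly continuous, hence the first-order Taylor remainder
  is small uniformly in \<open>z\<close>. This uniformity justifies differentiating under the
  integral sign.\<close>

lemma test_function_remainder:
  fixes \<phi> :: "real ^ 'n \<Rightarrow> real"
  assumes \<phi>: "\<phi> \<in> test_functions" and e: "e > 0"
  obtains d where "d > 0" "\<And>z h. norm h < d \<Longrightarrow>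
    \<bar>\<phi> (z + h) - \<phi> z - (\<Sum>i\<in>UNIV. h $ i * partial_deriv i \<phi> z)\<bar> \<le> e * norm h"
proof -
  \<comment> \<open>Each of the \<open>CARD('n)\<close> partial derivatives receives an equal share
    of the error.\<close>
  define e' where "e' = e / CARD('n)"
  have e': "e' > 0" using e by (simp add: e'_def)
  have "\<exists>d>0. \<forall>x y. dist x y < d \<longrightarrow> \<bar>partial_deriv i \<phi> x - partial_deriv i \<phi> y\<bar> < e'" for i
    using uniformly_continuous_bounded_support[OF _ _ e']
      test_functionsD(2,3)[OF partial_deriv_test_functions[OF \<phi>]] by metis
  then obtain D where D: "\<And>i. D i > 0"
    "\<And>i x y. dist x y < D i \<Longrightarrow> \<bar>partial_deriv i \<phi> x - partial_deriv i \<phi> y\<bar> < e'"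
    by metis
  define d where "d = Min (range D)"
  have d: "d > 0" "\<And>i. d \<le> D i" using D(1) by (auto simp: d_def)
  have "\<bar>\<phi> (z + h) - \<phi> z - (\<Sum>i\<in>UNIV. h $ i * partial_deriv i \<phi> z)\<bar> \<le> e * norm h"
    if h: "norm h < d" for z h
  proof -
    define L where "L w h = (\<Sum>i\<in>UNIV. h $ i * partial_deriv i \<phi> w)" for w h
    have der: "(\<phi> has_derivative L w) (at w within ball z d)" for w
      using has_derivative_partial_deriv[OF test_functionsD(4)[OF \<phi>]]
      unfolding L_def by (rule has_derivative_at_withinI)
    have bd: "onorm (\<lambda>v. L w v - L z v) \<le> e" if "w \<in> ball z d" for w
    proof (rule onorm_le)
      fix v :: "real ^ 'n"
      have "norm (L w v - L z v) = \<bar>\<Sum>i\<in>UNIV. v $ i * (partial_deriv i \<phi> w - partial_deriv i \<phi> z)\<bar>"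
        by (simp add: L_def sum_subtractf right_diff_distrib)
      also have "\<dots> \<le> (\<Sum>i\<in>UNIV. \<bar>v $ i * (partial_deriv i \<phi> w - partial_deriv i \<phi> z)\<bar>)"
        by (rule sum_abs)
      also have "\<dots> \<le> (\<Sum>i\<in>(UNIV :: 'n set). norm v * e')"
      proof (rule sum_mono)
        fix i :: 'n
        have "\<bar>partial_deriv i \<phi> w - partial_deriv i \<phi> z\<bar> < e'"
          using that d(2)[of i] by (intro D(2)) (auto simp: dist_commute)
        then show "\<bar>v $ i * (partial_deriv i \<phi> w - partial_deriv i \<phi> z)\<bar> \<le> norm v * e'"
          unfolding abs_mult by (intro mult_mono component_le_norm_cart) auto
      qed
      also have "\<dots> = e * norm v" by (simp add: e'_def)
      finally show "norm (L w v - L z v) \<le> e * norm v" .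
    qed
    have "norm (\<phi> (z + h) - \<phi> z - L z (z + h - z)) \<le> norm (z + h - z) * e"
    proof (rule differentiable_bound_linearization[where S = "ball z d" and f' = L and ?x0.0 = z])
      show "z + t *\<^sub>R (z + h - z) \<in> ball z d" if "t \<in> {0..1}" for t
      proof -
        have "norm (t *\<^sub>R h) \<le> 1 * norm h"
          using that unfolding norm_scaleR by (intro mult_right_mono) auto
        then show ?thesis using h by (simp add: dist_norm)
      qed
    qed (use d der bd in \<open>simp_all add: fun_diff_def\<close>)
    then show ?thesis by (simp add: L_def mult.commute)
  qed
  with d(1) show thesis using that by blast
qed

text \<open>By translation invariance the integrals of the difference quotients vanish, and these converge
  uniformly to the partial derivative; Fubini's theorem is not needed.\<close>

lemma integral_partial_deriv_test_function:
  fixes \<phi> :: "real ^ 'n \<Rightarrow> real"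
  assumes \<phi>: "\<phi> \<in> test_functions"
  shows "(LINT x|lebesgue. partial_deriv i \<phi> x) = 0"
proof -
  note c = test_functionsD(3)[OF \<phi>]
  obtain R where R: "R > 0" "\<And>x. norm x > R \<Longrightarrow> \<phi> x = 0"
    using continuous_bounded_supportE[OF c test_functionsD(2)[OF \<phi>]] by metis
  have R': "partial_deriv i \<phi> x = 0" if "norm x > R" for x
    by (rule partial_deriv_locally_const[of "- cball 0 R" _ _ 0]) (use that R in auto)
  let ?K = "cball 0 (R + 1) :: (real ^ 'n) set"
  define V where "V = (LINT x:?K|lebesgue. \<bar>1::real\<bar>)"
  have V: "V \<ge> 0"
    unfolding V_def set_lebesgue_integral_def by (rule integral_nonneg_AE) auto
  have c1: "continuous_on UNIV (partial_deriv i \<phi>)"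
    using test_functionsD(3)[OF partial_deriv_test_functions[OF \<phi>]] .
  have bound: "\<bar>LINT x|lebesgue. partial_deriv i \<phi> x\<bar> \<le> e * V" if e: "e > 0" for e
  proof -
    obtain d where d: "d > 0" "\<And>z h. norm h < d \<Longrightarrow>
      \<bar>\<phi> (z + h) - \<phi> z - (\<Sum>i\<in>UNIV. h $ i * partial_deriv i \<phi> z)\<bar> \<le> e * norm h"
      using test_function_remainder[OF \<phi> e] by blast
    \<comment> \<open>A step of length at most 1 keeps the support of the remainder \<open>u\<close>
      inside \<open>?K\<close>; a length below \<open>d\<close> makes the Taylor estimate
      applicable.\<close>
    define t where "t = min (d / 2) 1"
    have t: "t > 0" "t < d" "t \<le> 1" using d(1) by (auto simp: t_def min_def)
    define h :: "real ^ 'n" where "h = t *\<^sub>R axis i 1"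
    have h: "norm h = t" using t by (simp add: h_def)
    have hs: "(\<Sum>j\<in>UNIV. h $ j * p j) = t * p i" for p
      by (simp add: h_def axis_def if_distrib if_distribR cong: if_cong)
    define u where "u z = \<phi> (z + h) - \<phi> z - t * partial_deriv i \<phi> z" for z
    have cc: "continuous_on UNIV (\<lambda>z. \<phi> (h + 1 *\<^sub>R z))"
      by (rule continuous_on_compose2[OF c]) (auto intro!: continuous_intros)
    have cu: "continuous_on UNIV u"
      unfolding u_def using c c1 cc by (auto intro!: continuous_intros simp: add.commute)
    have "norm (z + h) > R" if "norm z > R + 1" for z
      using norm_triangle_ineq2[of z "-h"] h t that by simp
    then have u0: "u z = 0" if "z \<notin> ?K" for z
      using R R' that by (auto simp: u_def)
    have "\<bar>u z\<bar> \<le> e * t" for z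
      using d(2)[of h z] h t hs by (simp add: u_def)
    then have A: "\<bar>LINT x|lebesgue. u x * 1\<bar> \<le> e * t * V"
      unfolding V_def using u0
      by (intro L1_loc_mult_bounded(2) continuous_imp_L1_loc continuous_imp_measurable_lebesgue cu) auto
    have b: "bounded {x. \<phi> x \<noteq> 0}" using test_functionsD(2)[OF \<phi>] .
    have t': "(\<lambda>z. \<phi> (h + 1 *\<^sub>R z)) \<in> test_functions"
      by (rule test_functions_affine[OF \<phi>]) simp
    have "(LINT x|lebesgue. u x) =
        (LINT x|lebesgue. \<phi> (h + 1 *\<^sub>R x)) - (LINT x|lebesgue. \<phi> x) - t * (LINT x|lebesgue. partial_deriv i \<phi> x)"
      using integrable_continuous_bounded_support[OF test_functionsD(3,2)[OF t']]
        integrable_continuous_bounded_support[OF test_functionsD(3,2)[OF \<phi>]]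
        integrable_continuous_bounded_support[OF test_functionsD(3,2)[OF partial_deriv_test_functions[OF \<phi>, of i]]]
      unfolding u_def by (simp add: add.commute)
    also have "\<dots> = - (t * (LINT x|lebesgue. partial_deriv i \<phi> x))"
      using integral_lebesgue_affine[OF c, of 1 h] by simp
    finally have "t * \<bar>LINT x|lebesgue. partial_deriv i \<phi> x\<bar> \<le> t * (e * V)"
      using A t(1) by (simp add: abs_mult algebra_simps)
    then show ?thesis using t(1) by simp
  qed
  have "\<bar>LINT x|lebesgue. partial_deriv i \<phi> x\<bar> \<le> 0 + e" if "e > 0" for e
  proof -
    have "\<bar>LINT x|lebesgue. partial_deriv i \<phi> x\<bar> \<le> e / (V + 1) * V"
      using that V by (intro bound) auto
    also have "\<dots> \<le> e" using that V by (simp add: field_simps)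
    finally show ?thesis by simp
  qed
  then have "\<bar>LINT x|lebesgue. partial_deriv i \<phi> x\<bar> \<le> 0" by (rule field_le_epsilon)
  then show ?thesis by simp
qed

text \<open>Integration by parts: the product of two test functions is a test function, so its
  partial derivative has integral zero, and the product rule splits that integral.\<close>

lemma test_function_has_weak_partial:
  fixes \<phi> :: "real ^ 'n \<Rightarrow> real"
  assumes "\<phi> \<in> test_functions"
  shows "has_weak_partial \<phi> i (partial_deriv i \<phi>)"
  unfolding has_weak_partial_def
proof (intro conjI ballI)
  show "partial_deriv i \<phi> \<in> L1_loc"
    by (rule continuous_imp_L1_loc[OF test_functionsD(3)[OF partial_deriv_test_functions[OF assms]]])
  fix \<psi> :: "real ^ 'n \<Rightarrow> real" assume \<psi>: "\<psi> \<in> test_functions"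
  have m: "(\<lambda>x. \<phi> x * \<psi> x) \<in> test_functions"
    by (rule test_functions_mult[OF assms test_functionsD(1)[OF \<psi>]])
  have "0 = (LINT x|lebesgue. partial_deriv i (\<lambda>x. \<phi> x * \<psi> x) x)"
    using integral_partial_deriv_test_function[OF m] by simp
  also have "\<dots> = (LINT x|lebesgue. \<phi> x * partial_deriv i \<psi> x + partial_deriv i \<phi> x * \<psi> x)"
    by (simp add: partial_deriv_mult[OF test_functionsD(4)[OF assms] test_functionsD(4)[OF \<psi>]])
  also have "\<dots> = (LINT x|lebesgue. \<phi> x * partial_deriv i \<psi> x) + (LINT x|lebesgue. partial_deriv i \<phi> x * \<psi> x)"
    by (intro Bochner_Integration.integral_add L1_loc_mult_continuous continuous_imp_L1_loc
        test_functionsD(2,3) partial_deriv_test_functions assms \<psi>)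
  finally show "(LINT x|lebesgue. \<phi> x * partial_deriv i \<psi> x) = - (LINT x|lebesgue. partial_deriv i \<phi> x * \<psi> x)"
    by simp
qed

section \<open>Convolution with a test function\<close>

definition conv :: "(real ^ 'n \<Rightarrow> real) \<Rightarrow> (real ^ 'n \<Rightarrow> real) \<Rightarrow> real ^ 'n \<Rightarrow> real" where
  "conv \<phi> f x = (LINT y|lebesgue. \<phi> (x - y) * f y)"

lemma test_functions_reflect:
  "\<phi> \<in> test_functions \<Longrightarrow> (\<lambda>y. \<phi> (x - y)) \<in> test_functions"
  using test_functions_affine[of \<phi> "-1" x] by simp

lemma conv_integrable:
  assumes "\<phi> \<in> test_functions" "f \<in> L1_loc"
  shows "integrable lebesgue (\<lambda>y. \<phi> (x - y) * f y)"
  using test_functions_reflect[OF assms(1)] L1_loc_mult_continuous[OF assms(2)] test_functionsD(2,3)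
  by blast

text \<open>The point \<open>x\<close> enters only through the kernel, so the whole derivative falls
  on \<open>\<phi>\<close> and local integrability of \<open>f\<close> suffices. The uniform Taylor
  remainder of \<open>\<phi>\<close> is integrated against \<open>f\<close> over one fixed
  ball.\<close>

lemma has_derivative_conv:
  fixes \<phi> :: "real ^ 'n \<Rightarrow> real"
  assumes \<phi>: "\<phi> \<in> test_functions" and f: "f \<in> L1_loc"
  shows "(conv \<phi> f has_derivative (\<lambda>h. \<Sum>i\<in>UNIV. h $ i * conv (partial_deriv i \<phi>) f x)) (at x)"
  unfolding has_derivative_at_alt
proof (intro conjI allI impI)
  show "bounded_linear (\<lambda>h. \<Sum>i\<in>UNIV. h $ i * conv (partial_deriv i \<phi>) f x)"
    by (intro bounded_linear_sum bounded_linear_mult_const bounded_linear_vec_nth)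
  fix e :: real assume e: "e > 0"
  obtain R where R: "R > 0" "\<And>x. norm x > R \<Longrightarrow> \<phi> x = 0"
    using continuous_bounded_supportE[OF test_functionsD(3,2)[OF \<phi>]] by metis
  have R': "partial_deriv i \<phi> x = 0" if "norm x > R" for x i
    by (rule partial_deriv_locally_const[of "- cball 0 R" _ _ 0]) (use that R in auto)
  define I where "I = (LINT y:cball x (R + 1)|lebesgue. \<bar>f y\<bar>)"
  have I: "I \<ge> 0"
    unfolding I_def set_lebesgue_integral_def by (rule integral_nonneg_AE) auto
  \<comment> \<open>\<open>I\<close> is the integral of \<open>\<bar>f\<bar>\<close> over the ball
    outside which the remainder vanishes; the summand 1 guards against division by zero.\<close>
  obtain d where d: "d > 0" "\<And>z h. norm h < d \<Longrightarrow>
    \<bar>\<phi> (z + h) - \<phi> z - (\<Sum>i\<in>UNIV. h $ i * partial_deriv i \<phi> z)\<bar> \<le> e / (I + 1) * norm h"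
    using test_function_remainder[OF \<phi>, of "e / (I + 1)"] e I by auto
  show "\<exists>d>0. \<forall>y. norm (y - x) < d \<longrightarrow>
    norm (conv \<phi> f y - conv \<phi> f x - (\<Sum>i\<in>UNIV. (y - x) $ i * conv (partial_deriv i \<phi>) f x)) \<le> e * norm (y - x)"
  proof (intro exI[of _ "min d 1"] conjI allI impI)
    show "min d 1 > 0" using d(1) by simp
    fix y assume y: "norm (y - x) < min d 1"
    define h where "h = y - x"
    have h: "norm h < d" "norm h < 1" using y by (simp_all add: h_def)
    define u where "u w = \<phi> (y - w) - \<phi> (x - w) - (\<Sum>i\<in>UNIV. h $ i * partial_deriv i \<phi> (x - w))" for w
    have int: "integrable lebesgue (\<lambda>w. \<phi> (y - w) * f w)" "integrable lebesgue (\<lambda>w. \<phi> (x - w) * f w)"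
      "\<And>i. integrable lebesgue (\<lambda>w. partial_deriv i \<phi> (x - w) * f w)"
      by (intro conv_integrable \<phi> f partial_deriv_test_functions)+
    have "(LINT w|lebesgue. u w * f w) = (LINT w|lebesgue. \<phi> (y - w) * f w - \<phi> (x - w) * f w -
        (\<Sum>i\<in>UNIV. h $ i * (partial_deriv i \<phi> (x - w) * f w)))"
      by (simp add: u_def left_diff_distrib sum_distrib_right mult.assoc)
    also have "\<dots> = conv \<phi> f y - conv \<phi> f x - (\<Sum>i\<in>UNIV. h $ i * conv (partial_deriv i \<phi>) f x)"
      unfolding conv_def using int by (simp add: Bochner_Integration.integral_sum)
    finally have eq: "conv \<phi> f y - conv \<phi> f x - (\<Sum>i\<in>UNIV. h $ i * conv (partial_deriv i \<phi>) f x) =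
      (LINT w|lebesgue. u w * f w)" ..
    have "u \<in> borel_measurable lebesgue"
      unfolding u_def
      by (intro continuous_imp_measurable_lebesgue continuous_intros
          test_functionsD(3) test_functions_reflect partial_deriv_test_functions \<phi>)
    moreover have "\<bar>u w\<bar> \<le> e / (I + 1) * norm h" for w
    proof -
      have "x - w + h = y - w" by (simp add: h_def)
      then show ?thesis using d(2)[OF h(1), of "x - w"] by (simp only: u_def)
    qed
    moreover have "u w = 0" if "w \<notin> cball x (R + 1)" for w
    proof -
      have "norm (x - w) > R + 1" using that by (simp add: dist_norm)
      moreover have "norm (y - w) \<ge> norm (x - w) - norm h"
        using norm_triangle_ineq2[of "x - w" "-h"] by (simp add: h_def norm_minus_commute)
      ultimately show ?thesis using R R' h(2) by (simp add: u_def)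
    qed
    ultimately have "\<bar>LINT w|lebesgue. u w * f w\<bar> \<le> e / (I + 1) * norm h * I"
      unfolding I_def by (intro L1_loc_mult_bounded(2) f) auto
    also have "\<dots> = (I / (I + 1)) * (e * norm h)" by simp
    also have "\<dots> \<le> 1 * (e * norm h)"
      using I e by (intro mult_right_mono) auto
    finally show "norm (conv \<phi> f y - conv \<phi> f x - (\<Sum>i\<in>UNIV. (y - x) $ i * conv (partial_deriv i \<phi>) f x))
        \<le> e * norm (y - x)"
      using eq by (simp add: h_def)
  qed
qed

lemma partial_deriv_conv:
  fixes \<phi> :: "real ^ 'n \<Rightarrow> real"
  assumes "\<phi> \<in> test_functions" "f \<in> L1_loc"
  shows "partial_deriv i (conv \<phi> f) = conv (partial_deriv i \<phi>) f"
proof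
  fix x
  have "partial_deriv i (conv \<phi> f) x = (\<Sum>j\<in>UNIV. axis i 1 $ j * conv (partial_deriv j \<phi>) f x)"
    by (rule partial_deriv_eq[OF has_derivative_conv[OF assms]])
  also have "\<dots> = conv (partial_deriv i \<phi>) f x"
    by (simp add: axis_def if_distrib if_distribR cong: if_cong)
  finally show "partial_deriv i (conv \<phi> f) x = conv (partial_deriv i \<phi>) f x" .
qed

lemma Ck_conv:
  fixes \<phi> :: "real ^ 'n \<Rightarrow> real"
  assumes "\<phi> \<in> test_functions" "f \<in> L1_loc"
  shows "Ck k (conv \<phi> f)"
  using assms(1)
proof (induction k arbitrary: \<phi>)
  case 0
  then show ?case
    using has_derivative_continuous[OF has_derivative_conv[OF _ assms(2)]]
    by (simp add: continuous_on_eq_continuous_at)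
next
  case (Suc k)
  then show ?case
    using has_derivative_conv[OF Suc.prems assms(2)] partial_deriv_conv[OF Suc.prems assms(2)]
    by (auto simp: differentiable_on_UNIV differentiable_def partial_deriv_test_functions)
qed

text \<open>The reflected kernel \<open>\<lambda>y. \<phi> (x - y)\<close> is an admissible test
  function. Differentiating it in \<open>y\<close> yields a minus sign, which cancels the one in the
  definition of the weak derivative.\<close>

lemma conv_weak_partial:
  fixes \<phi> :: "real ^ 'n \<Rightarrow> real"
  assumes \<phi>: "\<phi> \<in> test_functions" and g: "has_weak_partial f i g"
  shows "conv (partial_deriv i \<phi>) f = conv \<phi> g"
proof
  fix x
  have p: "partial_deriv i (\<lambda>y. \<phi> (x - y)) y = - partial_deriv i \<phi> (x - y)" for y
    using partial_deriv_affine[of \<phi> x "-1" y i] test_functionsD(4)[OF \<phi>] by simp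
  have "(LINT y|lebesgue. f y * partial_deriv i (\<lambda>y. \<phi> (x - y)) y) =
      - (LINT y|lebesgue. g y * \<phi> (x - y))"
    using g test_functions_reflect[OF \<phi>] unfolding has_weak_partial_def by blast
  then show "conv (partial_deriv i \<phi>) f x = conv \<phi> g x"
    unfolding p conv_def by (simp add: mult.commute)
qed

lemma conv_support:
  fixes \<phi> :: "real ^ 'n \<Rightarrow> real"
  assumes "\<And>x. norm x > R \<Longrightarrow> \<phi> x = 0" "\<And>x. norm x > S \<Longrightarrow> f x = 0" "norm x > R + S"
  shows "conv \<phi> f x = 0"
proof -
  have "\<phi> (x - y) * f y = 0" for y
  proof -
    have "norm (x - y) > R \<or> norm y > S"
      using assms(3) norm_triangle_ineq2[of x y] by linarith
    then show ?thesis using assms(1,2) by auto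
  qed
  then show ?thesis by (simp only: conv_def) simp
qed

lemma conv_test_function:
  fixes \<phi> :: "real ^ 'n \<Rightarrow> real"
  assumes \<phi>: "\<phi> \<in> test_functions" and f: "f \<in> L1_loc" "\<And>x. norm x > S \<Longrightarrow> f x = 0"
  shows "conv \<phi> f \<in> test_functions"
proof -
  obtain R where R: "\<And>x. norm x > R \<Longrightarrow> \<phi> x = 0"
    using continuous_bounded_supportE[OF test_functionsD(3,2)[OF \<phi>]] by metis
  have "norm x \<le> R + S" if "conv \<phi> f x \<noteq> 0" for x
    using conv_support[of R \<phi> S f x] R f(2) that by force
  then have "bounded {x. conv \<phi> f x \<noteq> 0}"
    unfolding bounded_iff by blast
  then show ?thesis using Ck_conv[OF \<phi> f(1)] by (simp add: test_functions_iff)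
qed

section \<open>Mollifiers and uniqueness of weak derivatives\<close>

text \<open>Unfolded, this is the standard bump exp (-1 / (1 - |x|^2)) on the open unit ball,
  extended by zero.\<close>

definition bump :: "real ^ 'n \<Rightarrow> real" where
  "bump x = flat_exp 0 (1 - x \<bullet> x)"

lemma bump_nonneg: "bump x \<ge> 0"
  by (simp add: bump_def flat_exp_def)

lemma bump_pos: "norm x < 1 \<Longrightarrow> bump x > 0"
  and bump_eq_0: "norm x \<ge> 1 \<Longrightarrow> bump x = 0"
  using power2_norm_eq_inner[of x] abs_square_less_1[of "norm x"]
  by (auto simp: bump_def flat_exp_def)

lemma bump_test_function: "bump \<in> test_functions"
proof -
  have "bounded {x :: real ^ 'n. bump x \<noteq> 0}"
    unfolding bounded_iff using bump_eq_0 by (metis linorder_le_cases mem_Collect_eq)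
  then show ?thesis
    unfolding test_functions_iff bump_def by (auto intro: Ck_flat_exp)
qed

text \<open>A nonnegative function with integral zero vanishes almost everywhere, but
  \<open>bump\<close> is positive on the unit ball, which is open and so not negligible.\<close>

lemma integral_bump_pos: "(LINT x|lebesgue. bump (x :: real ^ 'n)) > 0"
proof -
  have int: "integrable lebesgue (bump :: real ^ 'n \<Rightarrow> real)"
    by (rule integrable_continuous_bounded_support[OF test_functionsD(3,2)[OF bump_test_function]])
  have "(LINT x|lebesgue. bump (x :: real ^ 'n)) \<noteq> 0"
  proof
    assume "(LINT x|lebesgue. bump (x :: real ^ 'n)) = 0"
    then have "AE x :: real ^ 'n in lebesgue. bump x = 0"
      using integral_nonneg_eq_0_iff_AE[OF int] by (simp add: bump_nonneg)
    then obtain S :: "(real ^ 'n) set" where S: "{x. bump x \<noteq> 0} \<subseteq> S" "S \<in> null_sets lebesgue"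
      by (auto elim!: AE_E simp: null_sets_def)
    have "ball 0 1 \<subseteq> S" using S(1) bump_pos by fastforce
    then have "negligible (ball (0 :: real ^ 'n) 1)"
      using S(2) negligible_iff_null_sets negligible_subset by blast
    then show False using open_not_negligible[of "ball (0 :: real ^ 'n) 1"] by simp
  qed
  moreover have "(LINT x|lebesgue. bump (x :: real ^ 'n)) \<ge> 0"
    by (rule integral_nonneg_AE) (simp add: bump_nonneg)
  ultimately show ?thesis by simp
qed

definition mollifier :: "real \<Rightarrow> real ^ 'n \<Rightarrow> real" where
  "mollifier e x = bump ((1 / e) *\<^sub>R x) / (e ^ CARD('n) * (LINT y|lebesgue. bump (y :: real ^ 'n)))"

lemma mollifier_nonneg: "e > 0 \<Longrightarrow> mollifier e x \<ge> 0"
  unfolding mollifier_def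
  by (intro divide_nonneg_nonneg mult_nonneg_nonneg bump_nonneg zero_le_power less_imp_le[OF integral_bump_pos]) simp

lemma mollifier_eq_0: "e > 0 \<Longrightarrow> norm x \<ge> e \<Longrightarrow> mollifier e x = 0"
  by (simp add: mollifier_def bump_eq_0)

lemma mollifier_test_function: "e > 0 \<Longrightarrow> mollifier e \<in> test_functions"
  unfolding mollifier_def[abs_def] divide_inverse[of "bump _"]
  using test_functions_affine[OF bump_test_function, of "1 / e" 0]
  by (intro test_functions_mult Ck_const) simp

lemma integral_mollifier_reflect:
  fixes x :: "real ^ 'n"
  assumes "e > 0"
  shows "(LINT y|lebesgue. mollifier e (x - y)) = 1"
proof -
  let ?c = "LINT y|lebesgue. bump (y :: real ^ 'n)"
  \<comment> \<open>The substitution has factor \<open>- (1 / e)\<close>; only its absolute value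
    enters the Jacobian, so the reflection is harmless.\<close>
  have "(LINT y|lebesgue. bump ((1 / e) *\<^sub>R (x - y))) = e ^ CARD('n) * ?c"
    using integral_lebesgue_affine[OF test_functionsD(3)[OF bump_test_function], of "- (1 / e)" "(1 / e) *\<^sub>R x"] assms
    by (simp add: scaleR_diff_right power_divide field_simps)
  then show ?thesis
    using assms integral_bump_pos[where 'n = 'n] by (simp add: mollifier_def)
qed

text \<open>Because the kernel is nonnegative with integral 1, the difference is a weighted mean of
  \<open>g y - g x\<close> over points \<open>y\<close> within distance \<open>e\<close> of
  \<open>x\<close>, and uniform continuity applies.\<close>

lemma conv_mollifier_uniform:
  fixes g :: "real ^ 'n \<Rightarrow> real"
  assumes g: "continuous_on UNIV g" "bounded {x. g x \<noteq> 0}" and \<eta>: "\<eta> > 0"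
  obtains d where "d > 0" "\<And>e x. 0 < e \<Longrightarrow> e < d \<Longrightarrow> \<bar>conv (mollifier e) g x - g x\<bar> \<le> \<eta>"
proof -
  obtain d where d: "d > 0" "\<And>x y. dist x y < d \<Longrightarrow> \<bar>g x - g y\<bar> < \<eta>"
    using uniformly_continuous_bounded_support[OF g \<eta>] by blast
  have "\<bar>conv (mollifier e) g x - g x\<bar> \<le> \<eta>" if e: "0 < e" "e < d" for e x
  proof -
    let ?m = "\<lambda>y. mollifier e (x - y)"
    have t: "?m \<in> test_functions"
      by (rule test_functions_reflect[OF mollifier_test_function[OF e(1)]])
    have i1: "integrable lebesgue ?m"
      by (rule integrable_continuous_bounded_support[OF test_functionsD(3,2)[OF t]])
    have i2: "integrable lebesgue (\<lambda>y. ?m y * g y)"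
      by (rule conv_integrable[OF mollifier_test_function[OF e(1)] continuous_imp_L1_loc[OF g(1)]])
    have i3: "integrable lebesgue (\<lambda>y. ?m y * (g y - g x))"
      using i1 i2 by (simp add: right_diff_distrib)
    have "conv (mollifier e) g x - g x = (LINT y|lebesgue. ?m y * (g y - g x))"
      using i1 i2 integral_mollifier_reflect[OF e(1), of x]
      by (simp add: conv_def right_diff_distrib)
    also have "\<bar>\<dots>\<bar> \<le> (LINT y|lebesgue. \<bar>?m y * (g y - g x)\<bar>)"
      by (rule integral_abs_bound)
    also have "\<dots> \<le> (LINT y|lebesgue. ?m y * \<eta>)"
    proof (rule integral_mono[OF integrable_abs[OF i3]])
      show "integrable lebesgue (\<lambda>y. ?m y * \<eta>)" using i1 by simp
      fix y
      show "\<bar>?m y * (g y - g x)\<bar> \<le> ?m y * \<eta>"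
      proof (cases "norm (x - y) < e")
        case True
        then have "\<bar>g y - g x\<bar> < \<eta>" using e d(2)[of y x] by (simp add: dist_norm norm_minus_commute)
        then show ?thesis
          using mollifier_nonneg[OF e(1), of "x - y"] by (simp add: abs_mult mult_left_mono)
      next
        case False
        then show ?thesis using mollifier_eq_0[OF e(1), of "x - y"] by simp
      qed
    qed
    also have "\<dots> = \<eta>"
      using i1 integral_mollifier_reflect[OF e(1), of x] by simp
    finally show ?thesis .
  qed
  with d(1) show thesis using that by blast
qed

text \<open>A measurable function is an almost everywhere limit of continuous ones. Clipping these
  to [-M, M] and multiplying by a continuous cutoff adds the uniform bound and the common support
  needed for dominated convergence.\<close>

lemma bounded_measurable_limit_continuous:
  fixes s :: "real ^ 'n \<Rightarrow> real"
  assumes s: "s \<in> borel_measurable lebesgue" "\<And>x. \<bar>s x\<bar> \<le> M" "\<And>x. norm x > R \<Longrightarrow> s x = 0"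
  obtains g where "\<And>k. continuous_on UNIV (g k)" "\<And>k x. \<bar>g k x\<bar> \<le> M"
    "\<And>k x. norm x > R + 1 \<Longrightarrow> g k x = 0" "AE x in lebesgue. (\<lambda>k. g k x) \<longlonglongrightarrow> s x"
proof -
  have "s measurable_on UNIV"
    using s(1) measurable_on_iff_borel_measurable[of UNIV s] by (simp add: lebesgue_on_UNIV_eq)
  then obtain S h where S: "negligible S" "\<And>k. continuous_on UNIV (h k :: real ^ 'n \<Rightarrow> real)"
    "\<And>x. x \<notin> S \<Longrightarrow> (\<lambda>k. h k x) \<longlonglongrightarrow> s x"
    unfolding measurable_on_def by auto
  have M: "M \<ge> 0" using s(2)[of undefined] by linarith
  \<comment> \<open>The cutoff is 1 on the ball of radius \<open>R\<close> and falls to 0 over the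
    next unit of length. Neither it nor the clipping changes the limit, as \<open>s\<close> already
    obeys both restrictions.\<close>
  define \<theta> :: "real ^ 'n \<Rightarrow> real" where "\<theta> x = max 0 (min 1 (R + 1 - norm x))" for x
  define g where "g k x = max (- M) (min M (h k x)) * \<theta> x" for k x
  show thesis
  proof (rule that[of g])
    show "continuous_on UNIV (g k)" for k
      unfolding g_def \<theta>_def by (intro continuous_intros S(2))
    show "\<bar>g k x\<bar> \<le> M" for k x
    proof -
      have "\<bar>max (- M) (min M (h k x))\<bar> * \<bar>\<theta> x\<bar> \<le> M * 1"
        using M by (intro mult_mono) (auto simp: \<theta>_def)
      then show ?thesis by (simp add: g_def abs_mult)
    qed
    show "g k x = 0" if "norm x > R + 1" for k x
      using that by (simp add: g_def \<theta>_def)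
    have "(\<lambda>k. g k x) \<longlonglongrightarrow> s x" if "x \<notin> S" for x
    proof -
      have "(\<lambda>k. g k x) \<longlonglongrightarrow> max (- M) (min M (s x)) * \<theta> x"
        unfolding g_def by (intro tendsto_intros S(3) that)
      moreover have "max (- M) (min M (s x)) * \<theta> x = s x"
        using s(2)[of x] s(3)[of x] by (cases "norm x > R") (auto simp: \<theta>_def)
      ultimately show ?thesis by simp
    qed
    then show "AE x in lebesgue. (\<lambda>k. g k x) \<longlonglongrightarrow> s x"
      using S(1) by (intro AE_I'[of S]) (auto simp: negligible_iff_null_sets)
  qed
qed

text \<open>Mollifications of \<open>g\<close> are test functions converging to it uniformly with
  supports in one fixed ball, so the vanishing of the integrals passes to the limit.\<close>

lemma integral_test_function_eq_0_imp_continuous: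
  fixes u g :: "real ^ 'n \<Rightarrow> real"
  assumes u: "u \<in> L1_loc" "\<And>\<phi>. \<phi> \<in> test_functions \<Longrightarrow> (LINT x|lebesgue. u x * \<phi> x) = 0"
    and g: "continuous_on UNIV g" "bounded {x. g x \<noteq> 0}"
  shows "(LINT x|lebesgue. u x * g x) = 0"
proof -
  obtain M R where R: "R > 0" "\<And>x. norm x > R \<Longrightarrow> g x = 0"
    using continuous_bounded_supportE[OF g] by metis
  define I where "I = (LINT y:cball 0 (1 + R)|lebesgue. \<bar>u y\<bar>)"
  have I: "I \<ge> 0"
    unfolding I_def set_lebesgue_integral_def by (rule integral_nonneg_AE) auto
  have "\<bar>LINT x|lebesgue. u x * g x\<bar> \<le> 0 + \<eta>" if \<eta>: "\<eta> > 0" for \<eta>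
  proof -
    obtain d where d: "d > 0" "\<And>e x. 0 < e \<Longrightarrow> e < d \<Longrightarrow> \<bar>conv (mollifier e) g x - g x\<bar> \<le> \<eta> / (I + 1)"
      using conv_mollifier_uniform[OF g, of "\<eta> / (I + 1)"] \<eta> I by auto
    \<comment> \<open>The bound \<open>e \<le> 1\<close> keeps every mollification inside the ball
      of radius \<open>1 + R\<close>, over which \<open>I\<close> was taken.\<close>
    define e where "e = min (d / 2) 1"
    have e: "e > 0" "e < d" "e \<le> 1" using d(1) by (auto simp: e_def min_def)
    define c where "c = conv (mollifier e) g"
    have c: "c \<in> test_functions"
      unfolding c_def by (rule conv_test_function[OF mollifier_test_function[OF e(1)] continuous_imp_L1_loc[OF g(1)] R(2)])
    have c0: "c x = 0" if "norm x > 1 + R" for x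
      unfolding c_def
    proof (rule conv_support[OF _ R(2) that])
      show "mollifier e y = 0" if "norm y > 1" for y :: "real ^ 'n"
        using mollifier_eq_0[OF e(1), of y] e(3) that by simp
    qed
    have ii: "integrable lebesgue (\<lambda>x. c x * u x)" "integrable lebesgue (\<lambda>x. g x * u x)"
      by (intro L1_loc_mult_continuous u(1) g test_functionsD(2,3) c)+
    have "\<bar>LINT x|lebesgue. (c x - g x) * u x\<bar> \<le> \<eta> / (I + 1) * I"
      unfolding I_def
    proof (rule L1_loc_mult_bounded(2)[OF u(1)])
      show "(\<lambda>x. c x - g x) \<in> borel_measurable lebesgue"
        by (intro continuous_imp_measurable_lebesgue continuous_intros g test_functionsD(3) c)
      show "\<bar>c x - g x\<bar> \<le> \<eta> / ((LINT y:cball 0 (1 + R)|lebesgue. \<bar>u y\<bar>) + 1)" for x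
        using d(2)[OF e(1,2)] by (simp add: c_def I_def)
    qed (use c0 R in auto)
    moreover have "(LINT x|lebesgue. (c x - g x) * u x) = - (LINT x|lebesgue. u x * g x)"
      using ii u(2)[OF c] by (simp add: left_diff_distrib mult.commute[of "u _"])
    moreover have "\<eta> / (I + 1) * I \<le> \<eta>" using \<eta> I by (simp add: field_simps)
    ultimately show ?thesis by simp
  qed
  then have "\<bar>LINT x|lebesgue. u x * g x\<bar> \<le> 0" by (rule field_le_epsilon)
  then show ?thesis by simp
qed

text \<open>Testing against continuous approximations of \<open>sgn u\<close> on a ball makes the integral of
  \<open>\<bar>u\<bar>\<close> over that ball vanish.\<close>

lemma fundamental_lemma:
  fixes u :: "real ^ 'n \<Rightarrow> real"
  assumes u: "u \<in> L1_loc" "\<And>\<phi>. \<phi> \<in> test_functions \<Longrightarrow> (LINT x|lebesgue. u x * \<phi> x) = 0"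
  shows "AE x in lebesgue. u x = 0"
proof -
  have [measurable]: "u \<in> borel_measurable lebesgue" by (rule L1_locD[OF u(1)])
  have "AE x in lebesgue. norm x \<le> real m \<longrightarrow> u x = 0" for m
  proof -
    define s where "s x = sgn (u x) * indicator (cball 0 (real m)) x" for x
    have "s \<in> borel_measurable lebesgue"
      unfolding s_def by (auto intro!: borel_measurable_times borel_measurable_indicator)
    moreover have "\<bar>s x\<bar> \<le> 1" "norm x > real m \<Longrightarrow> s x = 0" for x
      by (auto simp: s_def indicator_def sgn_real_def)
    ultimately obtain g where g: "\<And>k. continuous_on UNIV (g k)" "\<And>k x. \<bar>g k x\<bar> \<le> 1"
      "\<And>k x. norm x > real m + 1 \<Longrightarrow> g k x = 0" "AE x in lebesgue. (\<lambda>k. g k x) \<longlonglongrightarrow> s x"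
      using bounded_measurable_limit_continuous[of s 1 "real m"] by blast
    have [measurable]: "g k \<in> borel_measurable lebesgue" for k
      by (rule continuous_imp_measurable_lebesgue[OF g(1)])
    let ?K = "cball 0 (real m + 1) :: (real ^ 'n) set"
    have z: "(LINT x|lebesgue. u x * g k x) = 0" for k
    proof (rule integral_test_function_eq_0_imp_continuous[OF u g(1)])
      have "norm x \<le> real m + 1" if "g k x \<noteq> 0" for x
        using g(3)[of x k] that by linarith
      then show "bounded {x. g k x \<noteq> 0}" unfolding bounded_iff by blast
    qed
    have "(\<lambda>k. LINT x|lebesgue. u x * g k x) \<longlonglongrightarrow> (LINT x|lebesgue. u x * s x)"
    proof (rule integral_dominated_convergence[where w = "\<lambda>x. indicator ?K x *\<^sub>R \<bar>u x\<bar>"])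
      show "(\<lambda>x. u x * s x) \<in> borel_measurable lebesgue"
        using \<open>s \<in> borel_measurable lebesgue\<close> by simp
      show "integrable lebesgue (\<lambda>x. indicator ?K x *\<^sub>R \<bar>u x\<bar>)"
        using set_integrable_abs[OF L1_loc_set_integrable[OF u(1), of ?K]] by (simp add: set_integrable_def)
      show "AE x in lebesgue. (\<lambda>k. u x * g k x) \<longlonglongrightarrow> u x * s x"
        using g(4) by eventually_elim (rule tendsto_mult_left)
      show "AE x in lebesgue. norm (u x * g k x) \<le> indicator ?K x *\<^sub>R \<bar>u x\<bar>" for k
      proof (rule AE_I2)
        fix x
        show "norm (u x * g k x) \<le> indicator ?K x *\<^sub>R \<bar>u x\<bar>"
          using g(2)[of k x] g(3)[of x k] mult_left_mono[OF g(2)[of k x], of "\<bar>u x\<bar>"]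
          by (cases "x \<in> ?K") (auto simp: abs_mult)
      qed
    qed simp
    then have "(LINT x|lebesgue. u x * s x) = 0"
      unfolding z using LIMSEQ_unique tendsto_const by blast
    moreover have us: "u x * s x = indicator (cball 0 (real m)) x *\<^sub>R \<bar>u x\<bar>" for x
      by (simp add: s_def abs_sgn)
    moreover have int: "integrable lebesgue (\<lambda>x. indicator (cball 0 (real m)) x *\<^sub>R \<bar>u x\<bar>)"
      using set_integrable_abs[OF L1_loc_set_integrable[OF u(1), of "cball 0 (real m)"]]
      by (simp add: set_integrable_def)
    ultimately have "AE x in lebesgue. indicator (cball 0 (real m)) x *\<^sub>R \<bar>u x\<bar> = 0"
      using integral_nonneg_eq_0_iff_AE[OF int] by simp
    then show ?thesis by eventually_elim (auto simp: indicator_def split: if_splits)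
  qed
  then have "AE x in lebesgue. \<forall>m. norm x \<le> real m \<longrightarrow> u x = 0"
    unfolding AE_all_countable by blast
  then show ?thesis
    by eventually_elim (meson real_arch_simple)
qed

lemma has_weak_partial_unique:
  fixes f :: "real ^ 'n \<Rightarrow> real"
  assumes "has_weak_partial f i g" "has_weak_partial f i h"
  shows "AE x in lebesgue. g x = h x"
proof -
  have gh: "g \<in> L1_loc" "h \<in> L1_loc" using assms by (auto simp: has_weak_partial_def)
  have "AE x in lebesgue. g x - h x = 0"
  proof (rule fundamental_lemma[OF L1_loc_diff[OF gh]])
    fix \<phi> :: "real ^ 'n \<Rightarrow> real" assume \<phi>: "\<phi> \<in> test_functions"
    have "(LINT x|lebesgue. g x * \<phi> x) = (LINT x|lebesgue. h x * \<phi> x)"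
      using assms \<phi> unfolding has_weak_partial_def by (metis neg_equal_iff_equal)
    then show "(LINT x|lebesgue. (g x - h x) * \<phi> x) = 0"
      using L1_loc_mult_continuous[OF gh(1) test_functionsD(3,2)[OF \<phi>]]
        L1_loc_mult_continuous[OF gh(2) test_functionsD(3,2)[OF \<phi>]]
      by (simp add: left_diff_distrib mult.commute[of "\<phi> _"])
  qed
  then show ?thesis by simp
qed

text \<open>\<open>weak_partial\<close> is known only through its choice property; by uniqueness any
  explicitly computed weak derivative may replace it almost everywhere.\<close>

lemma weak_partial_AE:
  assumes "has_weak_partial f i g"
  shows "has_weak_partial f i (weak_partial i f)" "AE x in lebesgue. weak_partial i f x = g x"
proof -
  show *: "has_weak_partial f i (weak_partial i f)"
    unfolding weak_partial_def by (rule someI[of "has_weak_partial f i"]) (rule assms)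
  show "AE x in lebesgue. weak_partial i f x = g x"
    by (rule has_weak_partial_unique[OF * assms])
qed

lemma has_weak_partial_diff:
  fixes f :: "real ^ 'n \<Rightarrow> real"
  assumes f: "f \<in> L1_loc" "has_weak_partial f i g" and h: "h \<in> L1_loc" "has_weak_partial h i k"
  shows "has_weak_partial (\<lambda>x. f x - h x) i (\<lambda>x. g x - k x)"
  unfolding has_weak_partial_def
proof (intro conjI ballI)
  have gk: "g \<in> L1_loc" "k \<in> L1_loc" using assms by (auto simp: has_weak_partial_def)
  then show "(\<lambda>x. g x - k x) \<in> L1_loc" by (rule L1_loc_diff)
  fix \<phi> :: "real ^ 'n \<Rightarrow> real" assume \<phi>: "\<phi> \<in> test_functions"
  note \<phi>' = partial_deriv_test_functions[OF \<phi>, of i]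
  have I: "integrable lebesgue (\<lambda>x. w x * \<psi> x)" if "w \<in> L1_loc" "\<psi> \<in> test_functions" for w \<psi> :: "real ^ 'n \<Rightarrow> real"
    using L1_loc_mult_continuous[OF that(1) test_functionsD(3,2)[OF that(2)]] by (simp add: mult.commute)
  have "(LINT x|lebesgue. f x * partial_deriv i \<phi> x) = - (LINT x|lebesgue. g x * \<phi> x)"
    "(LINT x|lebesgue. h x * partial_deriv i \<phi> x) = - (LINT x|lebesgue. k x * \<phi> x)"
    using f(2) h(2) \<phi> unfolding has_weak_partial_def by blast+
  then show "(LINT x|lebesgue. (f x - h x) * partial_deriv i \<phi> x) = - (LINT x|lebesgue. (g x - k x) * \<phi> x)"
    using I[OF f(1) \<phi>'] I[OF h(1) \<phi>'] I[OF gk(1) \<phi>] I[OF gk(2) \<phi>]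
    by (simp add: left_diff_distrib)
qed

section \<open>Mollification in Muckenhoupt spaces\<close>

lemma tendsto_0_real_lessD:
  fixes a :: "nat \<Rightarrow> real"
  assumes "a \<longlonglongrightarrow> 0" "e > 0"
  shows "\<exists>K. \<forall>k\<ge>K. a k < e"
  using order_tendstoD(2)[OF assms] by (simp add: eventually_sequentially)

lemma absolutely_continuous_normD:
  assumes "absolutely_continuous_norm X N" "f \<in> X" "\<And>k. E k \<in> sets lebesgue" "decseq E" "(\<Inter>k. E k) = {}"
  shows "(\<lambda>k. N (\<lambda>x. f x * indicator (E k) x)) \<longlonglongrightarrow> 0"
proof -
  have "range E \<subseteq> sets lebesgue" using assms(3) by (rule image_subsetI)
  with assms(4,5) show ?thesis
    using assms(1)[unfolded absolutely_continuous_norm_def, THEN bspec, OF assms(2), THEN spec, of E] by simp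
qed

section \<open>Averaging operators and the grid of dilated cells\<close>

lemma averaging_op_scale:
  "averaging_op \<Q> (\<lambda>y. c * f y) = (\<lambda>x. c * averaging_op \<Q> f x)"
proof
  fix x
  have "averaging_op \<Q> (\<lambda>y. c * f y) x =
      (\<Sum>\<^sub>\<infinity>Q\<in>\<Q>. c * ((1 / measure lebesgue Q * (LINT y:Q|lebesgue. f y)) * indicator Q x))"
    unfolding averaging_op_def by (simp add: mult_ac)
  also have "\<dots> = c * averaging_op \<Q> f x"
    unfolding averaging_op_def by (rule infsum_cmult_right')
  finally show "averaging_op \<Q> (\<lambda>y. c * f y) x = c * averaging_op \<Q> f x" .
qed

lemma averaging_op_eq:
  assumes "disjoint \<Q>" "Q \<in> \<Q>" "x \<in> Q"
  shows "averaging_op \<Q> f x = 1 / measure lebesgue Q * (LINT y:Q|lebesgue. f y)"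
proof -
  have "averaging_op \<Q> f x = (\<Sum>\<^sub>\<infinity>Q\<in>{Q}. (1 / measure lebesgue Q * (LINT y:Q|lebesgue. f y)) * indicator Q x)"
    unfolding averaging_op_def
  proof (rule infsum_cong_neutral)
    fix P assume "P \<in> \<Q> - {Q}"
    then have "x \<notin> P" using assms unfolding disjoint_def by blast
    then show "(1 / measure lebesgue P * (LINT y:P|lebesgue. f y)) * indicator P x = 0"
      by simp
  qed (use assms(2) in auto)
  then show ?thesis using assms(3) by simp
qed

lemma averaging_op_nonneg:
  assumes "\<And>y. f y \<ge> 0"
  shows "averaging_op \<Q> f x \<ge> 0"
  unfolding averaging_op_def set_lebesgue_integral_def using assms
  by (intro infsum_nonneg mult_nonneg_nonneg divide_nonneg_nonneg integral_nonneg_AE) auto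

lemma cubesI: "l > 0 \<Longrightarrow> box a (a + (\<chi> i. l)) \<in> cubes"
  by (auto simp: cubes_def)

lemma measure_cube:
  fixes a :: "real ^ 'n"
  assumes "l > 0"
  shows "measure lebesgue (box a (a + (\<chi> i. l))) = l ^ CARD('n)"
proof -
  have "measure lebesgue (box a (a + (\<chi> i. l))) = measure lebesgue (cbox a (a + (\<chi> i. l)))"
    by (simp add: measure_lborel_box_eq measure_lborel_cbox_eq)
  also have "\<dots> = l ^ CARD('n)"
    using assms by (subst measure_completion) (auto simp: content_cbox_if_cart interval_eq_empty_cart not_less)
  finally show ?thesis .
qed

text \<open>The cell \<open>\<Prod>\<^sub>i [e m\<^sub>i, e (m\<^sub>i + 1))\<close> of the grid of mesh \<open>e\<close>, dilated by \<open>3\<close> about its centre.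
  It contains the \<open>e\<close>-neighbourhood of the cell, and the dilated cells with \<open>m\<close> in a fixed
  residue class modulo \<open>3\<close> are disjoint.\<close>

definition grid_cube :: "real \<Rightarrow> ('n \<Rightarrow> int) \<Rightarrow> (real ^ 'n) set" where
  "grid_cube e m = box (\<chi> i. e * (real_of_int (m i) - 1)) ((\<chi> i. e * (real_of_int (m i) - 1)) + (\<chi> i. 3 * e))"

definition grid_family :: "real \<Rightarrow> ('n \<Rightarrow> int) \<Rightarrow> (real ^ 'n) set set" where
  "grid_family e r = grid_cube e ` {m. \<forall>i. m i mod 3 = r i}"

abbreviation residues3 :: "('n \<Rightarrow> int) set" where
  "residues3 \<equiv> UNIV \<rightarrow>\<^sub>E {0..<3}"

lemma mem_grid_cube:
  "x \<in> grid_cube e m \<longleftrightarrow> (\<forall>i. e * (real_of_int (m i) - 1) < x $ i \<and> x $ i < e * (real_of_int (m i) + 2))"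
  by (simp add: grid_cube_def mem_box_cart algebra_simps)

lemma grid_family_subset_cubes: "e > 0 \<Longrightarrow> grid_family e r \<subseteq> cubes"
  unfolding grid_family_def grid_cube_def using cubesI[of "3 * e"] by auto

text \<open>In each coordinate the two intervals can meet only if the indices differ by less than 3;
  congruence modulo 3 then forces them to be equal.\<close>

lemma disjoint_grid_family:
  assumes e: "e > 0"
  shows "disjoint (grid_family e r)"
proof -
  have "grid_cube e m = grid_cube e m'"
    if m: "\<forall>i. m i mod 3 = r i" "\<forall>i. m' i mod 3 = r i" and x: "x \<in> grid_cube e m" "x \<in> grid_cube e m'" for m m' x
  proof -
    have "m i = m' i" for i
    proof -
      have "e * (real_of_int (m i) - 1) < e * (real_of_int (m' i) + 2)" "e * (real_of_int (m' i) - 1) < e * (real_of_int (m i) + 2)"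
        using x unfolding mem_grid_cube by (meson less_trans)+
      then have "real_of_int (m i) < m' i + 3" "real_of_int (m' i) < m i + 3"
        using e by auto
      then have "m i < m' i + 3" "m' i < m i + 3" by linarith+
      moreover have "m i mod 3 = m' i mod 3" using m by simp
      ultimately show ?thesis by presburger
    qed
    then have "m = m'" by blast
    then show ?thesis by simp
  qed
  then show ?thesis
    unfolding disjoint_def grid_family_def by blast
qed

lemma ball_subset_grid_cube:
  fixes x :: "real ^ 'n"
  assumes e: "e > 0"
  shows "ball x e \<subseteq> grid_cube e (\<lambda>i. \<lfloor>x $ i / e\<rfloor>)"
proof
  fix y assume y: "y \<in> ball x e"
  show "y \<in> grid_cube e (\<lambda>i. \<lfloor>x $ i / e\<rfloor>)"
    unfolding mem_grid_cube
  proof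
    fix i
    define k where "k = \<lfloor>x $ i / e\<rfloor>"
    have "of_int k \<le> x $ i / e" "x $ i / e < of_int k + 1"
      unfolding k_def by linarith+
    then have "e * of_int \<lfloor>x $ i / e\<rfloor> \<le> x $ i" "x $ i < e * (of_int \<lfloor>x $ i / e\<rfloor> + 1)"
      unfolding k_def[symmetric] using e by (simp_all add: field_simps)
    moreover have "\<bar>x $ i - y $ i\<bar> < e"
      using component_le_norm_cart[of "x - y" i] y by (simp add: dist_norm)
    ultimately show "e * (real_of_int \<lfloor>x $ i / e\<rfloor> - 1) < y $ i \<and> y $ i < e * (real_of_int \<lfloor>x $ i / e\<rfloor> + 2)"
      unfolding distrib_left right_diff_distrib by linarith
  qed
qed

text \<open>The kernel is at most B / (e^n c), with c the integral of \<open>bump\<close>, and lives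
  in the dilated cell, whose volume is (3 e)^n. The powers of \<open>e\<close> cancel, which makes
  the constant independent of the scale.\<close>

lemma conv_mollifier_le_averages:
  fixes f :: "real ^ 'n \<Rightarrow> real"
  assumes f: "f \<in> L1_loc" and e: "e > 0" and B: "\<And>x :: real ^ 'n. bump x \<le> B"
  shows "\<bar>conv (mollifier e) f x\<bar> \<le> B * 3 ^ CARD('n) / (LINT y|lebesgue. bump (y :: real ^ 'n)) *
    (\<Sum>r\<in>residues3. averaging_op (grid_family e r) (\<lambda>y. \<bar>f y\<bar>) x)"
proof -
  let ?c = "LINT y|lebesgue. bump (y :: real ^ 'n)"
  have c: "?c > 0" by (rule integral_bump_pos)
  have B0: "B \<ge> 0" using B[of 0] bump_nonneg[of "0 :: real ^ 'n"] by linarith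
  define m where "m = (\<lambda>i. \<lfloor>x $ i / e\<rfloor>)"
  define r where "r = (\<lambda>i. m i mod 3)"
  define Q where "Q = grid_cube e m"
  have r: "r \<in> residues3" by (auto simp: r_def)
  have Qin: "Q \<in> grid_family e r" by (auto simp: Q_def grid_family_def r_def)
  have sub: "ball x e \<subseteq> Q" unfolding Q_def m_def by (rule ball_subset_grid_cube[OF e])
  then have xQ: "x \<in> Q" using e by auto
  have mQ: "measure lebesgue Q = (3 * e) ^ CARD('n)"
    unfolding Q_def grid_cube_def using e by (intro measure_cube) simp
  have "set_integrable lebesgue Q (\<lambda>y. \<bar>f y\<bar>)"
  proof (rule set_integrable_subset[OF set_integrable_abs[OF L1_loc_set_integrable[OF f compact_cbox]]])
    show "Q \<subseteq> cbox (\<chi> i. e * (real_of_int (m i) - 1)) ((\<chi> i. e * (real_of_int (m i) - 1)) + (\<chi> i. 3 * e))"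
      unfolding Q_def grid_cube_def by (rule box_subset_cbox)
  qed (simp add: Q_def grid_cube_def)
  then have iQ: "integrable lebesgue (\<lambda>y. B / (e ^ CARD('n) * ?c) * (indicator Q y *\<^sub>R \<bar>f y\<bar>))"
    by (simp add: set_integrable_def)
  have "\<bar>conv (mollifier e) f x\<bar> \<le> (LINT y|lebesgue. \<bar>mollifier e (x - y) * f y\<bar>)"
    unfolding conv_def by (rule integral_abs_bound)
  also have "\<dots> \<le> (LINT y|lebesgue. B / (e ^ CARD('n) * ?c) * (indicator Q y *\<^sub>R \<bar>f y\<bar>))"
  proof (rule integral_mono[OF integrable_abs[OF conv_integrable[OF mollifier_test_function[OF e] f]] iQ])
    fix y
    show "\<bar>mollifier e (x - y) * f y\<bar> \<le> B / (e ^ CARD('n) * ?c) * (indicator Q y *\<^sub>R \<bar>f y\<bar>)"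
    proof (cases "y \<in> Q")
      case True
      have "mollifier e (x - y) \<le> B / (e ^ CARD('n) * ?c)"
        unfolding mollifier_def using B c e by (intro divide_right_mono) auto
      then show ?thesis
        using True mollifier_nonneg[OF e, of "x - y"] mult_right_mono[of _ _ "\<bar>f y\<bar>"]
        by (fastforce simp: abs_mult)
    next
      case False
      then have "norm (x - y) \<ge> e" using sub by (metis dist_norm in_mono linorder_not_le mem_ball)
      then show ?thesis using False mollifier_eq_0[OF e, of "x - y"] by simp
    qed
  qed
  also have "\<dots> = B / (e ^ CARD('n) * ?c) * (LINT y:Q|lebesgue. \<bar>f y\<bar>)"
    by (simp add: set_lebesgue_integral_def)
  also have "\<dots> = B * 3 ^ CARD('n) / ?c * averaging_op (grid_family e r) (\<lambda>y. \<bar>f y\<bar>) x"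
    using e c by (simp add: averaging_op_eq[OF disjoint_grid_family[OF e] Qin xQ] mQ power_mult_distrib)
  \<comment> \<open>The residue class \<open>r\<close> varies with \<open>x\<close>. Adding the
    nonnegative averages of all classes gives one bound valid at every point.\<close>
  also have "\<dots> \<le> B * 3 ^ CARD('n) / ?c * (\<Sum>r\<in>residues3. averaging_op (grid_family e r) (\<lambda>y. \<bar>f y\<bar>) x)"
    using B0 c by (intro mult_left_mono member_le_sum r averaging_op_nonneg finite_PiE) auto
  finally show ?thesis .
qed

section \<open>Norm estimates and dominated convergence in a Banach function space\<close>

context banach_function_space
begin

lemma diff: "f \<in> X \<Longrightarrow> g \<in> X \<Longrightarrow> (\<lambda>x. f x - g x) \<in> X"
  using add[of f "\<lambda>x. (- 1) * g x"] scale[of g "- 1"] by simp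

lemma norm_diff_triangle:
  assumes "f \<in> X" "g \<in> X" "h \<in> X"
  shows "N (\<lambda>x. f x - h x) \<le> N (\<lambda>x. f x - g x) + N (\<lambda>x. g x - h x)"
  using norm_triangle[OF diff[OF assms(1,2)] diff[OF assms(2,3)]] by simp

lemma norm_diff_commute:
  assumes "f \<in> X" "g \<in> X"
  shows "N (\<lambda>x. f x - g x) = N (\<lambda>x. g x - f x)"
  using norm_scale[OF diff[OF assms(2,1)], of "- 1"] by simp

lemma idealI:
  assumes "f \<in> X" "g \<in> borel_measurable lebesgue" "\<And>x. \<bar>g x\<bar> \<le> \<bar>f x\<bar>"
  shows "g \<in> X" "N g \<le> N f"
  using ideal[OF assms(1,2)] assms(3) by auto

lemma abs_mem: "f \<in> X \<Longrightarrow> (\<lambda>x. \<bar>f x\<bar>) \<in> X" "f \<in> X \<Longrightarrow> N (\<lambda>x. \<bar>f x\<bar>) \<le> N f"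
  using idealI[of f "\<lambda>x. \<bar>f x\<bar>"] measurable[of f] by auto

lemma sum_mem:
  assumes "finite I" "\<And>i. i \<in> I \<Longrightarrow> f i \<in> X"
  shows "(\<lambda>x. \<Sum>i\<in>I. f i x) \<in> X \<and> N (\<lambda>x. \<Sum>i\<in>I. f i x) \<le> (\<Sum>i\<in>I. N (f i))"
  using assms
proof (induction I rule: finite_induct)
  case empty
  then show ?case using zero norm_eq_0_iff[OF zero] by simp
next
  case (insert i I)
  then have *: "f i \<in> X" "(\<lambda>x. \<Sum>i\<in>I. f i x) \<in> X" "N (\<lambda>x. \<Sum>i\<in>I. f i x) \<le> (\<Sum>i\<in>I. N (f i))"
    by auto
  then show ?case using insert.hyps add[OF *(1,2)] norm_triangle[OF *(1,2)] by simp
qed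

text \<open>Off the set where some later \<open>\<bar>F j\<bar>\<close> exceeds \<open>\<delta> \<bar>g\<bar>\<close> the function \<open>F k\<close> is small,
  and these sets decrease to the empty set.\<close>

lemma norm_dominated_convergence:
  assumes ac: "absolutely_continuous_norm X N"
    and g: "g \<in> X" and F: "\<And>k. F k \<in> borel_measurable lebesgue"
    and dom: "\<And>k. AE x in lebesgue. \<bar>F k x\<bar> \<le> \<bar>g x\<bar>"
    and lim: "AE x in lebesgue. (\<lambda>k. F k x) \<longlonglongrightarrow> 0"
  shows "(\<lambda>k. N (F k)) \<longlonglongrightarrow> 0"
proof (rule LIMSEQ_I)
  fix \<epsilon> :: real assume \<epsilon>: "\<epsilon> > 0"
  have FX: "F k \<in> X" for k using ideal[OF g F dom] by blast
  note ag = abs_mem[OF g]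
  \<comment> \<open>Chosen so that \<open>\<delta>\<close> times the norm of
    \<open>\<bar>g\<bar>\<close> is at most half of \<open>\<epsilon>\<close>, even if that norm is
    zero.\<close>
  define \<delta> where "\<delta> = \<epsilon> / (2 * (N (\<lambda>x. \<bar>g x\<bar>) + 1))"
  have Ng: "N (\<lambda>x. \<bar>g x\<bar>) \<ge> 0" using norm_nonneg[OF ag(1)] .
  then have \<delta>: "\<delta> > 0" using \<epsilon> by (simp add: \<delta>_def)
  have "AE x in lebesgue. (\<forall>k. \<bar>F k x\<bar> \<le> \<bar>g x\<bar>) \<and> (\<lambda>k. F k x) \<longlonglongrightarrow> 0"
    using dom lim by (simp add: AE_all_countable)
  then obtain S where "{x \<in> space lebesgue. \<not> ((\<forall>k. \<bar>F k x\<bar> \<le> \<bar>g x\<bar>) \<and> (\<lambda>k. F k x) \<longlonglongrightarrow> 0)} \<subseteq> S"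
    "emeasure lebesgue S = 0" "S \<in> sets lebesgue"
    by (rule AE_E)
  then have S: "{x. \<not> ((\<forall>k. \<bar>F k x\<bar> \<le> \<bar>g x\<bar>) \<and> (\<lambda>k. F k x) \<longlonglongrightarrow> 0)} \<subseteq> S" "S \<in> null_sets lebesgue"
    by (simp_all add: null_sets_def)
  \<comment> \<open>The exceptional null set is removed because absolute continuity asks for an
    empty intersection, not merely a null one. Taking all \<open>j \<ge> k\<close> makes the sets
    decreasing.\<close>
  define E where "E k = {x. \<exists>j\<ge>k. \<bar>F j x\<bar> > \<delta> * \<bar>g x\<bar>} - S" for k
  note [measurable] = measurable[OF g] F
  have Em: "E k \<in> sets lebesgue" for k
  proof -
    have "{x \<in> space lebesgue. \<exists>j\<ge>k. \<bar>F j x\<bar> > \<delta> * \<bar>g x\<bar>} \<in> sets lebesgue"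
      by measurable
    from sets.Diff[OF this null_setsD2[OF S(2)]] show ?thesis
      unfolding E_def by (simp only: space_completion space_lborel space_borel UNIV_I simp_thms)
  qed
  have "decseq E"
    by (rule decseq_SucI) (auto simp: E_def intro: Suc_leD)
  moreover have "(\<Inter>k. E k) = {}"
  proof (rule ccontr)
    assume "(\<Inter>k. E k) \<noteq> {}"
    then obtain x where x: "\<And>k. x \<in> E k" by blast
    then have good: "\<And>k. \<bar>F k x\<bar> \<le> \<bar>g x\<bar>" "(\<lambda>k. F k x) \<longlonglongrightarrow> 0"
      using S(1) by (auto simp: E_def)
    have fr: "\<exists>j\<ge>k. \<bar>F j x\<bar> > \<delta> * \<bar>g x\<bar>" for k using x[of k] by (simp add: E_def)
    show False
    \<comment> \<open>Where \<open>g\<close> vanishes, domination forces all \<open>F k x\<close> to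
      be zero, so the strict inequality fails; elsewhere the threshold is positive and convergence
      contradicts it.\<close>
    proof (cases "g x = 0")
      case True
      then show False using fr[of 0] good(1) by (metis abs_zero mult_zero_right not_le)
    next
      case False
      then have "\<delta> * \<bar>g x\<bar> > 0" using \<delta> by simp
      from tendsto_0_real_lessD[OF tendsto_rabs_zero[OF good(2)] this]
      obtain K where "\<And>k. k \<ge> K \<Longrightarrow> \<bar>F k x\<bar> < \<delta> * \<bar>g x\<bar>"
        by blast
      then show False using fr[of K] less_asym by metis
    qed
  qed
  ultimately have "(\<lambda>k. N (\<lambda>x. \<bar>g x\<bar> * indicator (E k) x)) \<longlonglongrightarrow> 0"
    by (rule absolutely_continuous_normD[OF ac ag(1) Em])
  from tendsto_0_real_lessD[OF this half_gt_zero[OF \<epsilon>]]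
  obtain K where K: "\<And>k. k \<ge> K \<Longrightarrow> N (\<lambda>x. \<bar>g x\<bar> * indicator (E k) x) < \<epsilon> / 2"
    by blast
  have "norm (N (F k) - 0) < \<epsilon>" if k: "k \<ge> K" for k
  proof -
    note [measurable] = Em[of k]
    have gE: "(\<lambda>x. \<bar>g x\<bar> * indicator (E k) x) \<in> X"
      by (rule idealI(1)[OF g]) (auto simp: indicator_def)
    have h: "(\<lambda>x. \<delta> * \<bar>g x\<bar> + \<bar>g x\<bar> * indicator (E k) x) \<in> X"
      by (rule add[OF scale[OF ag(1)] gE])
    have "AE x in lebesgue. \<bar>F k x\<bar> \<le> \<bar>\<delta> * \<bar>g x\<bar> + \<bar>g x\<bar> * indicator (E k) x\<bar>"
    proof (rule AE_I'[OF S(2)], rule subsetI, rule ccontr)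
      fix x assume x: "x \<in> {x \<in> space lebesgue. \<not> \<bar>F k x\<bar> \<le> \<bar>\<delta> * \<bar>g x\<bar> + \<bar>g x\<bar> * indicator (E k) x\<bar>}" "x \<notin> S"
      then have "\<bar>F k x\<bar> \<le> \<bar>g x\<bar>" using S(1) by auto
      moreover have "\<bar>F k x\<bar> \<le> \<delta> * \<bar>g x\<bar>" if "x \<notin> E k"
        using that x(2) by (force simp: E_def)
      ultimately have "\<bar>F k x\<bar> \<le> \<delta> * \<bar>g x\<bar> + \<bar>g x\<bar> * indicator (E k) x"
        using \<delta> by (cases "x \<in> E k") (auto intro: add_increasing)
      then show False using x(1) by auto
    qed
    then have "N (F k) \<le> N (\<lambda>x. \<delta> * \<bar>g x\<bar> + \<bar>g x\<bar> * indicator (E k) x)"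
      using ideal[OF h F] by blast
    also have "\<dots> \<le> \<delta> * N (\<lambda>x. \<bar>g x\<bar>) + N (\<lambda>x. \<bar>g x\<bar> * indicator (E k) x)"
      using norm_triangle[OF scale[OF ag(1)] gE, of \<delta>] norm_scale[OF ag(1), of \<delta>] \<delta> by simp
    also have "\<dots> < \<epsilon> / 2 + \<epsilon> / 2"
    proof (rule add_le_less_mono[OF _ K[OF k]])
      show "\<delta> * N (\<lambda>x. \<bar>g x\<bar>) \<le> \<epsilon> / 2" using Ng \<epsilon> by (simp add: \<delta>_def field_simps)
    qed
    finally show ?thesis using norm_nonneg[OF FX] by simp
  qed
  then show "\<exists>K. \<forall>k\<ge>K. norm (N (F k) - 0) < \<epsilon>" by blast
qed

end

section \<open>Density of continuous functions and uniform bounds for mollification\<close>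

locale muckenhoupt_space = banach_function_space X N
  for X :: "(real ^ 'n \<Rightarrow> real) set" and N +
  assumes ac: "absolutely_continuous_norm X N"
    and sm: "strong_muckenhoupt X N"
begin

lemmas norm_indicator_tendsto_0 = absolutely_continuous_normD[OF ac]

lemma cball_subset_cube:
  obtains Q where "Q \<in> cubes" "cball (0 :: real ^ 'n) R \<subseteq> Q"
proof
  let ?a = "\<chi> i. - (\<bar>R\<bar> + 1) :: real ^ 'n"
  show "box ?a (?a + (\<chi> i. 2 * (\<bar>R\<bar> + 1))) \<in> cubes"
    by (rule cubesI) simp
  show "cball 0 R \<subseteq> box ?a (?a + (\<chi> i. 2 * (\<bar>R\<bar> + 1)))"
  proof
    fix x :: "real ^ 'n" assume x: "x \<in> cball 0 R"
    have "- (\<bar>R\<bar> + 1) < x $ i \<and> x $ i < - (\<bar>R\<bar> + 1) + 2 * (\<bar>R\<bar> + 1)" for i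
      using component_le_norm_cart[of x i] x by auto
    then show "x \<in> box ?a (?a + (\<chi> i. 2 * (\<bar>R\<bar> + 1)))"
      by (simp only: mem_box_cart vector_add_component vec_lambda_beta) blast
  qed
qed

text \<open>A compact set lies in a cube whose indicator belongs to the associate space;
  integrability of \<open>f\<close> against that indicator is integrability over the cube.\<close>

lemma subset_L1_loc: "X \<subseteq> L1_loc"
proof
  fix f assume f: "f \<in> X"
  have "set_integrable lebesgue K f" if K: "compact K" for K
  proof -
    obtain R where R: "K \<subseteq> cball 0 R"
      using compact_imp_bounded[OF K] unfolding bounded_iff by (auto simp: subset_iff)
    obtain Q :: "(real ^ 'n) set" where Q: "Q \<in> cubes" "cball 0 R \<subseteq> Q"
      by (rule cball_subset_cube[of R])
    then have "indicator Q \<in> associate_space X"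
      using sm by (auto simp: strong_muckenhoupt_def)
    then have "set_integrable lebesgue Q f"
      using f by (simp add: associate_space_def set_integrable_def mult.commute)
    then show ?thesis
      by (rule set_integrable_subset[OF _ fmeasurableD[OF lmeasurable_compact[OF K]] subset_trans[OF R Q(2)]])
  qed
  then show "f \<in> L1_loc" using measurable[OF f] by (simp add: L1_loc_def)
qed

lemma indicator_cball_mem: "indicator (cball 0 R) \<in> X"
proof -
  obtain Q :: "(real ^ 'n) set" where Q: "Q \<in> cubes" "cball 0 R \<subseteq> Q"
    by (rule cball_subset_cube[of R])
  then have "indicator Q \<in> X" using sm by (auto simp: strong_muckenhoupt_def)
  then show ?thesis
    by (rule idealI(1)) (use Q in \<open>auto simp: indicator_def borel_measurable_indicator\<close>)
qed

text \<open>This converts uniform smallness on a fixed ball into smallness in the norm of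
  \<open>X\<close>.\<close>

lemma bounded_support_mem:
  assumes s: "s \<in> borel_measurable lebesgue" "\<And>x. \<bar>s x\<bar> \<le> M" "\<And>x. norm x > R \<Longrightarrow> s x = 0"
  shows "s \<in> X" "N s \<le> M * N (indicator (cball 0 R))"
proof -
  have M: "M \<ge> 0" using s(2)[of undefined] by linarith
  have *: "(\<lambda>x. M * indicator (cball 0 R) x) \<in> X" by (rule scale[OF indicator_cball_mem])
  have le: "\<bar>s x\<bar> \<le> \<bar>M * indicator (cball 0 R) x\<bar>" for x
    using s(2)[of x] s(3)[of x] M by (auto simp: indicator_def)
  show "s \<in> X" by (rule idealI(1)[OF * s(1) le])
  have "N s \<le> N (\<lambda>x. M * indicator (cball 0 R) x)" by (rule idealI(2)[OF * s(1) le])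
  then show "N s \<le> M * N (indicator (cball 0 R))"
    using norm_scale[OF indicator_cball_mem[of R], of M] M by simp
qed

lemma continuous_bounded_support_mem:
  assumes "continuous_on UNIV g" "bounded {x. g x \<noteq> 0}"
  shows "g \<in> X"
  using continuous_bounded_supportE[OF assms] bounded_support_mem(1)[OF continuous_imp_measurable_lebesgue[OF assms(1)]]
  by metis

text \<open>Truncating \<open>f\<close> in space and in height costs little, since the sets
  \<open>E m\<close> decrease to the empty set. The truncation is bounded with bounded support,
  hence a dominated limit of continuous functions.\<close>

lemma continuous_dense:
  assumes f: "f \<in> X" and \<epsilon>: "\<epsilon> > 0"
  obtains g where "continuous_on UNIV g" "bounded {x. g x \<noteq> 0}" "N (\<lambda>x. f x - g x) < \<epsilon>"
proof -
  note [measurable] = measurable[OF f]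
  define E where "E m = {x. \<not> (norm x \<le> real m \<and> \<bar>f x\<bar> \<le> real m)}" for m
  have Em: "E m \<in> sets lebesgue" for m
  proof -
    have "{x \<in> space lebesgue. \<bar>f x\<bar> \<le> real m} \<inter> cball 0 (real m) \<in> sets lebesgue"
      by (intro sets.Int) (measurable, simp)
    moreover have "E m = - ({x \<in> space lebesgue. \<bar>f x\<bar> \<le> real m} \<inter> cball 0 (real m))"
      by (auto simp: E_def)
    ultimately show ?thesis
      by (simp only: Compl_in_sets_lebesgue)
  qed
  have "decseq E"
    by (rule decseq_SucI) (auto simp: E_def)
  moreover have "(\<Inter>m. E m) = {}"
  proof -
    have "\<exists>m. x \<notin> E m" for x
      using real_arch_simple[of "max (norm x) \<bar>f x\<bar>"] by (simp add: E_def)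
    then show ?thesis by blast
  qed
  ultimately have "(\<lambda>m. N (\<lambda>x. f x * indicator (E m) x)) \<longlonglongrightarrow> 0"
    by (rule norm_indicator_tendsto_0[OF f Em])
  from tendsto_0_real_lessD[OF this half_gt_zero[OF \<epsilon>]]
  obtain m where m: "N (\<lambda>x. f x * indicator (E m) x) < \<epsilon> / 2"
    by blast
  define s where "s x = f x * indicator (- E m) x" for x
  have "- E m \<in> sets lebesgue"
    by (simp only: Compl_in_sets_lebesgue Em)
  then have s: "s \<in> borel_measurable lebesgue"
    unfolding s_def by (intro borel_measurable_times borel_measurable_indicator measurable[OF f])
  have s': "\<bar>s x\<bar> \<le> real m" "norm x > real m \<Longrightarrow> s x = 0" for x
    by (auto simp: s_def E_def indicator_def)
  note s = s s'
  obtain g where g: "\<And>k. continuous_on UNIV (g k)" "\<And>k x. \<bar>g k x\<bar> \<le> real m"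
    "\<And>k x. norm x > real m + 1 \<Longrightarrow> g k x = 0" "AE x in lebesgue. (\<lambda>k. g k x) \<longlonglongrightarrow> s x"
    using bounded_measurable_limit_continuous[OF s] by blast
  have gb: "bounded {x. g k x \<noteq> 0}" for k
  proof -
    have "norm x \<le> real m + 1" if "g k x \<noteq> 0" for x
      using g(3)[of x k] that by linarith
    then show ?thesis unfolding bounded_iff by blast
  qed
  note gm = continuous_imp_measurable_lebesgue[OF g(1)]
  have sX: "s \<in> X" by (rule bounded_support_mem(1)[OF s])
  have "(\<lambda>k. N (\<lambda>x. s x - g k x)) \<longlonglongrightarrow> 0"
  \<comment> \<open>The dominating function comes from the bound \<open>real m\<close> for both
    \<open>s\<close> and \<open>g k\<close>, and from the support of \<open>g k\<close>, which
    exceeds that of \<open>s\<close> by one unit of radius.\<close>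
  proof (rule norm_dominated_convergence[OF ac scale[OF indicator_cball_mem[of "real m + 1"], of "2 * real m"]])
    show "(\<lambda>x. s x - g k x) \<in> borel_measurable lebesgue" for k
      using s(1) gm by measurable
    show "AE x in lebesgue. \<bar>s x - g k x\<bar> \<le> \<bar>2 * real m * indicator (cball 0 (real m + 1)) x\<bar>" for k
    proof (rule AE_I2)
      fix x
      have "\<bar>s x - g k x\<bar> \<le> 2 * real m" using s(2)[of x] g(2)[of k x] by linarith
      moreover have "s x - g k x = 0" if "norm x > real m + 1"
        using s(3)[of x] g(3)[of x k] that by simp
      ultimately show "\<bar>s x - g k x\<bar> \<le> \<bar>2 * real m * indicator (cball 0 (real m + 1)) x\<bar>"
        by (cases "norm x \<le> real m + 1") auto
    qed
    show "AE x in lebesgue. (\<lambda>k. s x - g k x) \<longlonglongrightarrow> 0"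
      using g(4) by eventually_elim (auto intro: tendsto_eq_intros)
  qed
  from tendsto_0_real_lessD[OF this half_gt_zero[OF \<epsilon>]]
  obtain k where k: "N (\<lambda>x. s x - g k x) < \<epsilon> / 2"
    by blast
  have "N (\<lambda>x. f x - g k x) \<le> N (\<lambda>x. f x - s x) + N (\<lambda>x. s x - g k x)"
    by (rule norm_diff_triangle[OF f sX continuous_bounded_support_mem[OF g(1) gb]])
  moreover have "(\<lambda>x. f x - s x) = (\<lambda>x. f x * indicator (E m) x)"
    by (auto simp: s_def indicator_def)
  ultimately have "N (\<lambda>x. f x - g k x) < \<epsilon>" using m k by simp
  then show thesis using that[OF g(1) gb] by blast
qed

text \<open>\<open>operator_norm\<close> looks only at functions of norm at most 1, so
  \<open>f\<close> is rescaled. A positive bound \<open>t\<close> in place of \<open>N f\<close>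
  itself avoids dividing by a vanishing norm.\<close>

lemma averaging_op_bounded:
  obtains C where "C \<ge> 0"
    "\<And>\<Q> f t. \<Q> \<subseteq> cubes \<Longrightarrow> disjoint \<Q> \<Longrightarrow> f \<in> X \<Longrightarrow> t > 0 \<Longrightarrow> N f \<le> t \<Longrightarrow>
      averaging_op \<Q> f \<in> X \<and> N (averaging_op \<Q> f) \<le> C * t"
proof
  let ?C = "enn2real (strong_muckenhoupt_const X N)"
  show "?C \<ge> 0" by simp
  fix \<Q> :: "(real ^ 'n) set set" and f and t :: real
  assume Q: "\<Q> \<subseteq> cubes" "disjoint \<Q>" and f: "f \<in> X" "t > 0" "N f \<le> t"
  have fin: "strong_muckenhoupt_const X N < \<infinity>" using sm by (simp add: strong_muckenhoupt_def)
  define g where "g x = (1 / t) * f x" for x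
  have g: "g \<in> X" "N g \<le> 1"
    using scale[OF f(1), of "1 / t"] norm_scale[OF f(1), of "1 / t"] f by (simp_all add: g_def[abs_def])
  have "(if averaging_op \<Q> g \<in> X then ennreal (N (averaging_op \<Q> g)) else \<infinity>) \<le> operator_norm X N (averaging_op \<Q>)"
    unfolding operator_norm_def by (rule SUP_upper) (use g in simp)
  also have "\<dots> \<le> strong_muckenhoupt_const X N"
    unfolding strong_muckenhoupt_const_def by (rule SUP_upper) (use Q in simp)
  also have "\<dots> = ennreal ?C" using fin by simp
  finally have *: "(if averaging_op \<Q> g \<in> X then ennreal (N (averaging_op \<Q> g)) else \<infinity>) \<le> ennreal ?C" .
  \<comment> \<open>The operator norm is finite, which excludes the branch with value
    \<open>\<infinity>\<close>.\<close>
  then have gX: "averaging_op \<Q> g \<in> X" by (auto split: if_splits simp: top_unique)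
  then have gC: "N (averaging_op \<Q> g) \<le> ?C" using * by (simp add: ennreal_le_iff)
  have "averaging_op \<Q> f = (\<lambda>x. t * averaging_op \<Q> g x)"
    using averaging_op_scale[of \<Q> t g] f(2) by (simp add: g_def)
  then show "averaging_op \<Q> f \<in> X \<and> N (averaging_op \<Q> f) \<le> ?C * t"
    using scale[OF gX, of t] norm_scale[OF gX, of t] gC f(2) by (simp add: mult.commute)
qed

text \<open>The bound is the product of the pointwise constant \<open>b\<close>, the number
  \<open>n\<close> of residue classes and the bound \<open>C\<close> for the averaging operators;
  none of them depends on \<open>e\<close>.\<close>

lemma conv_mollifier_bounded:
  obtains K where "K \<ge> 0" "\<And>e f t. e > 0 \<Longrightarrow> f \<in> X \<Longrightarrow> t > 0 \<Longrightarrow> N f \<le> t \<Longrightarrow>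
    conv (mollifier e) f \<in> X \<and> N (conv (mollifier e) f) \<le> K * t"
proof -
  obtain C where C: "C \<ge> 0"
    "\<And>\<Q> f t. \<Q> \<subseteq> cubes \<Longrightarrow> disjoint \<Q> \<Longrightarrow> f \<in> X \<Longrightarrow> t > 0 \<Longrightarrow> N f \<le> t \<Longrightarrow>
      averaging_op \<Q> f \<in> X \<and> N (averaging_op \<Q> f) \<le> C * t"
    using averaging_op_bounded by blast
  obtain B where B: "\<And>x :: real ^ 'n. \<bar>bump x\<bar> \<le> B"
    using continuous_bounded_supportE[OF test_functionsD(3,2)[OF bump_test_function]] by metis
  have B': "bump x \<le> B" for x :: "real ^ 'n" using B[of x] by linarith
  have B0: "B \<ge> 0" using B[of 0] by linarith
  define b where "b = B * 3 ^ CARD('n) / (LINT y|lebesgue. bump (y :: real ^ 'n))"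
  have b: "b \<ge> 0" using B0 integral_bump_pos[where 'n = 'n] by (simp add: b_def)
  define n where "n = real (card (residues3 :: ('n \<Rightarrow> int) set))"
  have "conv (mollifier e) f \<in> X \<and> N (conv (mollifier e) f) \<le> b * n * C * t"
    if e: "e > 0" and f: "f \<in> X" and t: "t > 0" "N f \<le> t" for e f t
  proof -
    have fl: "f \<in> L1_loc" using subset_L1_loc f by blast
    define A where "A r = averaging_op (grid_family e r) (\<lambda>y. \<bar>f y\<bar>)" for r
    have A: "A r \<in> X \<and> N (A r) \<le> C * t" for r
      unfolding A_def using abs_mem[OF f] t
      by (intro C(2) grid_family_subset_cubes disjoint_grid_family e) auto
    have fin: "finite (residues3 :: ('n \<Rightarrow> int) set)" by (intro finite_PiE) auto
    have S: "(\<lambda>x. \<Sum>r\<in>residues3. A r x) \<in> X" "N (\<lambda>x. \<Sum>r\<in>residues3. A r x) \<le> (\<Sum>r\<in>residues3. N (A r))"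
      using sum_mem[OF fin, of A] A by auto
    have "(\<Sum>r\<in>residues3. N (A r)) \<le> n * (C * t)"
      unfolding n_def using A by (intro sum_bounded_above) auto
    then have S': "N (\<lambda>x. b * (\<Sum>r\<in>residues3. A r x)) \<le> b * n * C * t"
      using S b norm_scale[OF S(1), of b] by (simp add: mult.assoc mult_left_mono)
    have c: "conv (mollifier e) f \<in> borel_measurable lebesgue"
      using Ck_conv[OF mollifier_test_function[OF e] fl, of 0] by (intro continuous_imp_measurable_lebesgue) simp
    have "\<bar>conv (mollifier e) f x\<bar> \<le> \<bar>b * (\<Sum>r\<in>residues3. A r x)\<bar>" for x
      using order_trans[OF conv_mollifier_le_averages[OF fl e B'] abs_ge_self] unfolding b_def A_def .
    then show ?thesis
      using idealI[OF scale[OF S(1), of b] c] S' by force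
  qed
  then show thesis using that[of "b * n * C"] b C(1) by (simp add: n_def)
qed

lemma conv_mollifier_mem: "e > 0 \<Longrightarrow> f \<in> X \<Longrightarrow> conv (mollifier e) f \<in> X"
  by (rule conv_mollifier_bounded) (use norm_nonneg[of f] in \<open>metis add_nonneg_pos less_add_one less_imp_le zero_less_one\<close>)

text \<open>The error is split through a continuous \<open>g\<close> near \<open>f\<close>: the
  uniform bound handles the mollification of \<open>f - g\<close>, uniform convergence on a ball
  handles \<open>g\<close>. The eventual form lets finitely many functions share one
  \<open>e\<close>.\<close>

lemma conv_mollifier_approx:
  assumes f: "f \<in> X" and \<epsilon>: "\<epsilon> > 0"
  shows "\<forall>\<^sub>F e in at_right 0. N (\<lambda>x. f x - conv (mollifier e) f x) < \<epsilon>"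
proof -
  obtain K where K: "K \<ge> 0" "\<And>e f t. e > 0 \<Longrightarrow> f \<in> X \<Longrightarrow> t > 0 \<Longrightarrow> N f \<le> t \<Longrightarrow>
    conv (mollifier e) f \<in> X \<and> N (conv (mollifier e) f) \<le> K * t"
    using conv_mollifier_bounded by blast
  \<comment> \<open>This gives \<open>K * t + t = \<epsilon> / 2\<close>, the cost of replacing
    \<open>f\<close> by \<open>g\<close> before and after mollification; the error for
    \<open>g\<close> is at most \<open>\<epsilon> / 4\<close>.\<close>
  define t where "t = \<epsilon> / 2 / (K + 1)"
  have t: "t > 0" using \<epsilon> K(1) by (simp add: t_def)
  obtain g where g: "continuous_on UNIV g" "bounded {x. g x \<noteq> 0}" "N (\<lambda>x. f x - g x) < t"
    using continuous_dense[OF f t] by blast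
  obtain M R where R: "R > 0" "\<And>x. norm x > R \<Longrightarrow> g x = 0"
    using continuous_bounded_supportE[OF g(1,2)] by metis
  define I where "I = N (indicator (cball 0 (1 + R)))"
  have I: "I \<ge> 0" unfolding I_def by (rule norm_nonneg[OF indicator_cball_mem])
  have gX: "g \<in> X" by (rule continuous_bounded_support_mem[OF g(1,2)])
  have fl: "f \<in> L1_loc" "g \<in> L1_loc" using subset_L1_loc f gX by auto
  obtain d where d: "d > 0" "\<And>e x. 0 < e \<Longrightarrow> e < d \<Longrightarrow> \<bar>conv (mollifier e) g x - g x\<bar> \<le> \<epsilon> / (4 * (I + 1))"
    using conv_mollifier_uniform[OF g(1,2), of "\<epsilon> / (4 * (I + 1))"] \<epsilon> I by auto
  have "N (\<lambda>x. f x - conv (mollifier e) f x) < \<epsilon>" if e: "0 < e" "e < min d 1" for e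
  proof -
    note m = mollifier_test_function[OF e(1)]
    have cX: "conv (mollifier e) f \<in> X" "conv (mollifier e) g \<in> X"
      using conv_mollifier_mem e(1) f gX by auto
    have "conv (mollifier e) (\<lambda>x. f x - g x) = (\<lambda>x. conv (mollifier e) f x - conv (mollifier e) g x)"
      using conv_integrable[OF m fl(1)] conv_integrable[OF m fl(2)]
      by (simp add: conv_def fun_eq_iff right_diff_distrib)
    then have 1: "N (\<lambda>x. conv (mollifier e) f x - conv (mollifier e) g x) \<le> K * t"
      using K(2)[OF e(1) diff[OF f gX] t] g(3) by simp
    have 2: "N (\<lambda>x. conv (mollifier e) g x - g x) \<le> \<epsilon> / (4 * (I + 1)) * I"
      unfolding I_def
    proof (rule bounded_support_mem(2))
      show "(\<lambda>x. conv (mollifier e) g x - g x) \<in> borel_measurable lebesgue"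
        using measurable[OF diff[OF cX(2) gX]] .
      show "\<bar>conv (mollifier e) g x - g x\<bar> \<le> \<epsilon> / (4 * (N (indicator (cball 0 (1 + R))) + 1))" for x
        using d(2)[of e x] e by (simp add: I_def)
      fix x :: "real ^ 'n" assume x: "norm x > 1 + R"
      have "conv (mollifier e) g x = 0"
      proof (rule conv_support[OF _ R(2) x])
        show "mollifier e y = 0" if "norm y > 1" for y :: "real ^ 'n"
          using mollifier_eq_0[OF e(1), of y] e(2) that by simp
      qed
      then show "conv (mollifier e) g x - g x = 0" using R x by simp
    qed
    have "\<epsilon> / (4 * (I + 1)) * I \<le> \<epsilon> / 4" using I \<epsilon> by (simp add: field_simps)
    moreover have "K * t + t = \<epsilon> / 2"
    proof -
      have "K * t + t = (K + 1) * t" by (simp add: algebra_simps)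
      also have "\<dots> = (K + 1) * (\<epsilon> / 2) / (K + 1)"
        unfolding t_def by (rule times_divide_eq_right)
      also have "\<dots> = \<epsilon> / 2"
        using K(1) by (intro nonzero_mult_div_cancel_left) simp
      finally show ?thesis .
    qed
    moreover have "N (\<lambda>x. f x - conv (mollifier e) f x) \<le> N (\<lambda>x. f x - g x) + N (\<lambda>x. g x - conv (mollifier e) f x)"
      by (rule norm_diff_triangle[OF f gX cX(1)])
    moreover have "N (\<lambda>x. g x - conv (mollifier e) f x) \<le>
        N (\<lambda>x. g x - conv (mollifier e) g x) + N (\<lambda>x. conv (mollifier e) g x - conv (mollifier e) f x)"
      by (rule norm_diff_triangle[OF gX cX(2,1)])
    ultimately show ?thesis
      using 1 2 g(3) \<epsilon> norm_diff_commute[OF gX cX(2)] norm_diff_commute[OF cX] by linarith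
  qed
  then show ?thesis
    using d(1) unfolding eventually_at_right_field by (intro exI[of _ "min d 1"]) auto
qed

end

section \<open>Smooth cutoffs and density\<close>

lemma integral_reflect:
  fixes g :: "real ^ 'n \<Rightarrow> real"
  assumes "continuous_on UNIV g"
  shows "(LINT y|lebesgue. g (x - y)) = (LINT y|lebesgue. g y)"
  using integral_lebesgue_affine[OF assms, of "- 1" x] by simp

text \<open>The indicator of a ball is mollified at the fixed scale 1. Derivatives fall on the
  kernel, so they are bounded by the integrals \<open>d i\<close>, which do not involve
  \<open>R\<close>.\<close>

lemma cutoff_functions:
  obtains D where "D \<ge> 0"
    "\<And>R :: real. \<exists>\<eta>\<in>test_functions. (\<forall>x :: real ^ 'n. 0 \<le> \<eta> x \<and> \<eta> x \<le> 1) \<and>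
      (\<forall>x i. \<bar>partial_deriv i \<eta> x\<bar> \<le> D) \<and>
      (\<forall>x. norm x < R \<longrightarrow> \<eta> x = 1 \<and> (\<forall>i. partial_deriv i \<eta> x = 0))"
proof -
  let ?m = "mollifier 1 :: real ^ 'n \<Rightarrow> real"
  have m: "?m \<in> test_functions" by (rule mollifier_test_function) simp
  note pm = partial_deriv_test_functions[OF m]
  define d where "d i = (LINT y|lebesgue. \<bar>partial_deriv i ?m y\<bar>)" for i
  have d0: "d i \<ge> 0" for i unfolding d_def by (rule integral_nonneg_AE) simp
  define D where "D = (\<Sum>i\<in>UNIV. d i)"
  have dD: "d i \<le> D" for i
    unfolding D_def using d0 by (intro member_le_sum) auto
  have "\<exists>\<eta>\<in>test_functions. (\<forall>x :: real ^ 'n. 0 \<le> \<eta> x \<and> \<eta> x \<le> 1) \<and>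
      (\<forall>x i. \<bar>partial_deriv i \<eta> x\<bar> \<le> D) \<and>
      (\<forall>x. norm x < R \<longrightarrow> \<eta> x = 1 \<and> (\<forall>i. partial_deriv i \<eta> x = 0))" for R :: real
  proof -
    define J where "J = (indicator (cball 0 (R + 1)) :: real ^ 'n \<Rightarrow> real)"
    define \<eta> where "\<eta> = conv ?m J"
    have J: "J \<in> L1_loc"
    proof -
      have "set_integrable lebesgue K J" if K: "compact K" for K
      proof -
        have "integrable lebesgue (indicator (K \<inter> cball 0 (R + 1)) :: real ^ 'n \<Rightarrow> real)"
          using lmeasurable_compact[OF compact_Int[OF K compact_cball[of 0 "R + 1"]]]
          by (simp only: integrable_indicator_iff Int_UNIV_right space_completion space_lborel space_borel)
            (auto simp: fmeasurable_def)
        then show ?thesis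
          by (simp add: set_integrable_def J_def indicator_inter_arith[abs_def])
      qed
      moreover have "J \<in> borel_measurable lebesgue"
        unfolding J_def by (intro borel_measurable_indicator) simp
      ultimately show ?thesis by (simp add: L1_loc_def)
    qed
    have \<eta>: "\<eta> \<in> test_functions"
      unfolding \<eta>_def by (rule conv_test_function[OF m J, of "R + 1"]) (simp add: J_def)
    have im: "integrable lebesgue (\<lambda>y. ?m (x - y))" for x
      using test_functions_reflect[OF m] by (intro integrable_continuous_bounded_support test_functionsD(2,3))
    \<comment> \<open>The unit ball around such an \<open>x\<close> lies where \<open>J\<close>
      equals 1, so the convolution integrates the whole kernel.\<close>
    have one: "\<eta> x = 1" if x: "norm x < R" for x
    proof -
      have "?m (x - y) * J y = ?m (x - y)" for y
      proof (cases "norm (x - y) < 1")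
        case True
        then have "norm y \<le> R + 1" using norm_triangle_ineq2[of y x] x by (simp add: norm_minus_commute)
        then show ?thesis by (simp add: J_def)
      next
        case False
        then show ?thesis using mollifier_eq_0[of 1 "x - y"] by simp
      qed
      then show ?thesis
        using integral_mollifier_reflect[of 1 x] by (simp only: \<eta>_def conv_def zero_less_one)
    qed
    have "0 \<le> \<eta> x \<and> \<eta> x \<le> 1" for x
    proof
      show "0 \<le> \<eta> x"
        unfolding \<eta>_def conv_def
        by (rule integral_nonneg_AE) (simp add: mollifier_nonneg J_def)
      have "\<eta> x \<le> (LINT y|lebesgue. ?m (x - y))"
        unfolding \<eta>_def conv_def
        by (intro integral_mono conv_integrable m J im)
          (simp add: J_def indicator_def mollifier_nonneg)
      then show "\<eta> x \<le> 1" using integral_mollifier_reflect[of 1 x] by simp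
    qed
    moreover have "\<bar>partial_deriv i \<eta> x\<bar> \<le> D" for x i
    proof -
      have c: "continuous_on UNIV (\<lambda>y. \<bar>partial_deriv i ?m y\<bar>)"
        by (intro continuous_intros test_functionsD(3) pm)
      have "integrable lebesgue (\<lambda>y. partial_deriv i ?m (x - y))"
        using test_functions_reflect[OF pm] by (intro integrable_continuous_bounded_support test_functionsD(2,3))
      then have ip: "integrable lebesgue (\<lambda>y. \<bar>partial_deriv i ?m (x - y)\<bar>)"
        by (rule integrable_abs)
      have "\<bar>partial_deriv i \<eta> x\<bar> \<le> (LINT y|lebesgue. \<bar>partial_deriv i ?m (x - y) * J y\<bar>)"
        unfolding \<eta>_def partial_deriv_conv[OF m J] unfolding conv_def by (rule integral_abs_bound)
      also have "\<dots> \<le> (LINT y|lebesgue. \<bar>partial_deriv i ?m (x - y)\<bar>)"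
        by (intro integral_mono integrable_abs[OF conv_integrable[OF pm J]] ip)
          (simp add: J_def indicator_def)
      also have "\<dots> = d i"
        unfolding d_def by (rule integral_reflect[OF c])
      finally show ?thesis using dD[of i] by simp
    qed
    moreover have "partial_deriv i \<eta> x = 0" if "norm x < R" for x i
      by (rule partial_deriv_locally_const[of "ball 0 R" _ _ 1]) (use that one in auto)
    ultimately show ?thesis using \<eta> one by blast
  qed
  moreover have "D \<ge> 0" unfolding D_def using d0 by (simp add: sum_nonneg)
  ultimately show thesis using that by blast
qed

section \<open>Approximation in the Sobolev norm\<close>

context muckenhoupt_space
begin

text \<open>The chosen \<open>weak_partial\<close> agrees with the classical derivative only almost
  everywhere, so membership in \<open>X\<close> passes through the ideal property.\<close>

lemma test_functions_subset_sobolev_space: "test_functions \<subseteq> sobolev_space X"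
proof
  fix \<phi> :: "real ^ 'n \<Rightarrow> real" assume \<phi>: "\<phi> \<in> test_functions"
  note w = test_function_has_weak_partial[OF \<phi>]
  have "\<phi> \<in> W11_loc"
    using w continuous_imp_L1_loc[OF test_functionsD(3)[OF \<phi>]] by (auto simp: W11_loc_def)
  moreover have "\<phi> \<in> X"
    by (rule continuous_bounded_support_mem[OF test_functionsD(3,2)[OF \<phi>]])
  moreover have "weak_partial i \<phi> \<in> X" for i
  proof -
    have "partial_deriv i \<phi> \<in> X"
      using partial_deriv_test_functions[OF \<phi>] by (intro continuous_bounded_support_mem test_functionsD(2,3))
    moreover have "weak_partial i \<phi> \<in> borel_measurable lebesgue"
      using weak_partial_AE(1)[OF w[of i]] by (auto simp: has_weak_partial_def dest: L1_locD)
    moreover have "AE x in lebesgue. \<bar>weak_partial i \<phi> x\<bar> \<le> \<bar>partial_deriv i \<phi> x\<bar>"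
      using weak_partial_AE(2)[OF w[of i]] by eventually_elim simp
    ultimately show ?thesis using ideal by blast
  qed
  ultimately show "\<phi> \<in> sobolev_space X" by (simp add: sobolev_space_def)
qed

text \<open>The Euclidean norm of the gradient is at most the sum of the absolute values of its
  components. This reduces the vector estimate to scalar ones, for whichever representatives are at
  hand.\<close>

lemma sobolev_norm_le:
  assumes w: "\<And>i. has_weak_partial h i (w i)" "\<And>i. w i \<in> X"
  shows "sobolev_norm N h \<le> N h + (\<Sum>i\<in>UNIV. N (w i))"
proof -
  have S: "(\<lambda>x. \<Sum>i\<in>UNIV. \<bar>w i x\<bar>) \<in> X" "N (\<lambda>x. \<Sum>i\<in>UNIV. \<bar>w i x\<bar>) \<le> (\<Sum>i\<in>UNIV. N (\<lambda>x. \<bar>w i x\<bar>))"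
    using sum_mem[of UNIV "\<lambda>i x. \<bar>w i x\<bar>"] abs_mem[OF w(2)] by auto
  have [measurable]: "weak_partial i h \<in> borel_measurable lebesgue" for i
    using weak_partial_AE(1)[OF w(1)] by (auto simp: has_weak_partial_def dest: L1_locD)
  have "(\<lambda>x. norm (weak_gradient h x)) \<in> borel_measurable lebesgue"
    by (simp add: weak_gradient_def norm_vec_def L2_set_def)
  moreover have "AE x in lebesgue. \<forall>i\<in>UNIV. weak_partial i h x = w i x"
    by (rule AE_finite_allI) (simp_all add: weak_partial_AE(2)[OF w(1)])
  then have "AE x in lebesgue. \<bar>norm (weak_gradient h x)\<bar> \<le> \<bar>\<Sum>i\<in>UNIV. \<bar>w i x\<bar>\<bar>"
  proof eventually_elim
    case (elim x)
    have "norm (weak_gradient h x) \<le> (\<Sum>i\<in>UNIV. \<bar>weak_gradient h x $ i\<bar>)"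
      by (rule norm_le_l1_cart)
    then show ?case using elim by (simp add: weak_gradient_def)
  qed
  ultimately have "N (\<lambda>x. norm (weak_gradient h x)) \<le> N (\<lambda>x. \<Sum>i\<in>UNIV. \<bar>w i x\<bar>)"
    using ideal[OF S(1)] by blast
  also have "\<dots> \<le> (\<Sum>i\<in>UNIV. N (w i))"
    using S(2) abs_mem(2)[OF w(2)] by (meson order_trans sum_mono)
  finally show ?thesis by (simp add: sobolev_norm_def)
qed

lemma norm_tail_less:
  assumes "f \<in> X" "\<delta> > 0"
  shows "\<forall>\<^sub>F k in sequentially. N (\<lambda>x. f x * indicator (- ball 0 (real k)) x) < \<delta>"
proof (rule order_tendstoD(2)[OF norm_indicator_tendsto_0[OF assms(1)] assms(2)])
  show "- ball (0 :: real ^ 'n) (real k) \<in> sets lebesgue" for k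
    by (simp only: Compl_in_sets_lebesgue) simp
  show "decseq (\<lambda>k. - ball (0 :: real ^ 'n) (real k))"
    by (rule decseq_SucI) auto
  have "\<exists>k. x \<in> ball 0 (real k)" for x :: "real ^ 'n"
    using reals_Archimedean2[of "norm x"] by simp
  then show "(\<Inter>k. - ball (0 :: real ^ 'n) (real k)) = {}" by blast
qed

text \<open>The approximant is \<open>\<eta>\<close> times the mollification \<open>u\<close>. Its
  error is (f - u) + (1 - \<eta>) u; in each partial derivative the corresponding error carries the
  extra term from the derivative of \<open>\<eta>\<close>.\<close>

lemma test_functions_dense:
  assumes f: "f \<in> sobolev_space X" and \<epsilon>: "\<epsilon> > 0"
  shows "\<exists>\<phi>\<in>test_functions. sobolev_norm N (\<lambda>x. f x - \<phi> x) < \<epsilon>"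
proof -
  define g where "g i = weak_partial i f" for i
  have fX: "f \<in> X" and gX: "g i \<in> X" and fl: "f \<in> L1_loc" for i
    using f by (auto simp: sobolev_space_def W11_loc_def g_def)
  have fg: "has_weak_partial f i (g i)" for i
    using f weak_partial_AE(1)[of f i] by (auto simp: sobolev_space_def W11_loc_def g_def)
  obtain D where D: "D \<ge> 0"
    "\<And>R :: real. \<exists>\<eta>\<in>test_functions. (\<forall>x :: real ^ 'n. 0 \<le> \<eta> x \<and> \<eta> x \<le> 1) \<and>
      (\<forall>x i. \<bar>partial_deriv i \<eta> x\<bar> \<le> D) \<and>
      (\<forall>x. norm x < R \<longrightarrow> \<eta> x = 1 \<and> (\<forall>i. partial_deriv i \<eta> x = 0))"
    using cutoff_functions[where 'n = 'n] by blast
  \<comment> \<open>The function contributes two units of \<open>\<delta>\<close> and each partial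
    derivative \<open>2 + D\<close>; the third unit makes the final inequality strict.\<close>
  define c where "c = 3 + real CARD('n) * (2 + D)"
  have c: "c > 0" using D(1) by (simp add: c_def add_pos_nonneg)
  define \<delta> where "\<delta> = \<epsilon> / c"
  have \<delta>: "\<delta> > 0" using c \<epsilon> by (simp add: \<delta>_def)
  have "\<forall>\<^sub>F e in at_right 0. 0 < e \<and> N (\<lambda>x. f x - conv (mollifier e) f x) < \<delta> \<and>
      (\<forall>i\<in>UNIV. N (\<lambda>x. g i x - conv (mollifier e) (g i) x) < \<delta>)"
    using \<delta> fX gX
    by (intro eventually_conj eventually_ball_finite ballI conv_mollifier_approx)
      (auto simp: eventually_at_right_less)
  \<comment> \<open>One scale serves \<open>f\<close> and all its partial derivatives, because only
    finitely many eventual conditions are combined.\<close>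
  then obtain e :: real where e: "e > 0" "N (\<lambda>x. f x - conv (mollifier e) f x) < \<delta>"
    "\<And>i. N (\<lambda>x. g i x - conv (mollifier e) (g i) x) < \<delta>"
    using eventually_happens'[OF trivial_limit_at_right_real] by blast
  define u where "u = conv (mollifier e) f"
  define v where "v i = conv (mollifier e) (g i)" for i
  note m = mollifier_test_function[OF e(1)]
  have uX: "u \<in> X" and vX: "v i \<in> X" for i
    using conv_mollifier_mem[OF e(1)] fX gX by (auto simp: u_def v_def)
  have uC: "Ck k u" for k unfolding u_def by (rule Ck_conv[OF m fl])
  have ud: "u differentiable at x" for x
    using uC[of "Suc 0"] by (simp add: differentiable_on_UNIV)
  have uv: "partial_deriv i u = v i" for i
    unfolding u_def v_def partial_deriv_conv[OF m fl] by (rule conv_weak_partial[OF m fg])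
  have "\<forall>\<^sub>F k in sequentially. N (\<lambda>x. u x * indicator (- ball 0 (real k)) x) < \<delta> \<and>
      (\<forall>i\<in>UNIV. N (\<lambda>x. v i x * indicator (- ball 0 (real k)) x) < \<delta>)"
    by (intro eventually_conj eventually_ball_finite ballI norm_tail_less uX vX \<delta>) simp
  \<comment> \<open>The radius is fixed after the scale: the tails to be made small are those of the
    mollified functions, not of \<open>f\<close> and \<open>g i\<close>.\<close>
  then obtain k where k: "N (\<lambda>x. u x * indicator (- ball 0 (real k)) x) < \<delta>"
    "\<And>i. N (\<lambda>x. v i x * indicator (- ball 0 (real k)) x) < \<delta>"
    using eventually_happens'[OF trivial_limit_sequentially] by blast
  obtain \<eta> :: "real ^ 'n \<Rightarrow> real" where \<eta>: "\<eta> \<in> test_functions" "\<And>x. 0 \<le> \<eta> x" "\<And>x. \<eta> x \<le> 1"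
    "\<And>x i. \<bar>partial_deriv i \<eta> x\<bar> \<le> D" "\<And>x. norm x < real k \<Longrightarrow> \<eta> x = 1"
    "\<And>x i. norm x < real k \<Longrightarrow> partial_deriv i \<eta> x = 0"
    using D(2)[of "real k"] by blast
  define \<phi> where "\<phi> x = \<eta> x * u x" for x
  have \<phi>: "\<phi> \<in> test_functions"
    unfolding \<phi>_def by (rule test_functions_mult[OF \<eta>(1) uC])
  have \<phi>': "partial_deriv i \<phi> x = \<eta> x * v i x + partial_deriv i \<eta> x * u x" for i x
    unfolding \<phi>_def using partial_deriv_mult[OF test_functionsD(4)[OF \<eta>(1)] ud] by (simp add: uv)
  note [measurable] = continuous_imp_measurable_lebesgue[OF test_functionsD(3)[OF \<eta>(1)]]
    continuous_imp_measurable_lebesgue[OF test_functionsD(3)[OF partial_deriv_test_functions[OF \<eta>(1)]]]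
  have tailX: "(\<lambda>x. h x * indicator (- ball 0 (real k)) x) \<in> X" if "h \<in> X" for h
  proof (rule idealI(1)[OF that])
    have "- ball (0 :: real ^ 'n) (real k) \<in> sets lebesgue"
      by (simp only: Compl_in_sets_lebesgue) simp
    then show "(\<lambda>x. h x * indicator (- ball 0 (real k)) x) \<in> borel_measurable lebesgue"
      by (intro borel_measurable_times borel_measurable_indicator measurable[OF that])
  qed (simp add: indicator_def)
  have cut: "(\<lambda>x. (1 - \<eta> x) * h x) \<in> X \<and> N (\<lambda>x. (1 - \<eta> x) * h x) < \<delta>"
    if h: "h \<in> X" "N (\<lambda>x. h x * indicator (- ball 0 (real k)) x) < \<delta>" for h
  proof -
    note [measurable] = measurable[OF h(1)]
    have "\<bar>(1 - \<eta> x) * h x\<bar> \<le> \<bar>h x * indicator (- ball 0 (real k)) x\<bar>" for x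
      using \<eta>(2,3)[of x] \<eta>(5)[of x] mult_right_mono[of "1 - \<eta> x" 1 "\<bar>h x\<bar>"]
      by (cases "norm x < real k") (auto simp: abs_mult)
    then show ?thesis
      using idealI[OF tailX[OF h(1)], of "\<lambda>x. (1 - \<eta> x) * h x"] h(2) by simp
  qed
  \<comment> \<open>The derivative of the cutoff vanishes for \<open>norm x < real k\<close> and is
    bounded by \<open>D\<close>, so this term is at most \<open>D\<close> times the tail of
    \<open>u\<close>.\<close>
  have slope: "(\<lambda>x. partial_deriv i \<eta> x * u x) \<in> X \<and> N (\<lambda>x. partial_deriv i \<eta> x * u x) \<le> D * \<delta>" for i
  proof -
    note [measurable] = measurable[OF uX]
    have "\<bar>partial_deriv i \<eta> x * u x\<bar> \<le> \<bar>D * (u x * indicator (- ball 0 (real k)) x)\<bar>" for x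
      using \<eta>(4)[of i x] \<eta>(6)[of x i] D(1) mult_right_mono[of "\<bar>partial_deriv i \<eta> x\<bar>" D "\<bar>u x\<bar>"]
      by (cases "norm x < real k") (auto simp: abs_mult)
    then have "(\<lambda>x. partial_deriv i \<eta> x * u x) \<in> X \<and> N (\<lambda>x. partial_deriv i \<eta> x * u x) \<le>
        N (\<lambda>x. D * (u x * indicator (- ball 0 (real k)) x))"
      using idealI[OF scale[OF tailX[OF uX], of D], of "\<lambda>x. partial_deriv i \<eta> x * u x"] by simp
    then show ?thesis
      using norm_scale[OF tailX[OF uX], of D] mult_left_mono[OF less_imp_le[OF k(1)] D(1)] D(1) by simp
  qed
  define w where "w i x = g i x - partial_deriv i \<phi> x" for i x
  have N0: "N (\<lambda>x. f x - \<phi> x) \<le> 2 * \<delta>"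
  proof -
    have "(\<lambda>x. f x - \<phi> x) = (\<lambda>x. (f x - u x) + (1 - \<eta> x) * u x)"
      by (simp add: \<phi>_def algebra_simps)
    then have "N (\<lambda>x. f x - \<phi> x) \<le> N (\<lambda>x. f x - u x) + N (\<lambda>x. (1 - \<eta> x) * u x)"
      using norm_triangle[OF diff[OF fX uX] cut[OF uX k(1), THEN conjunct1]] by simp
    then show ?thesis using e(2) cut[OF uX k(1)] by (simp add: u_def)
  qed
  have wN: "w i \<in> X \<and> N (w i) \<le> (2 + D) * \<delta>" for i
  proof -
    \<comment> \<open>\<open>p\<close> collects the mollification error and the cutoff error of the
      derivative; subtracting the slope term gives exactly \<open>w i\<close>.\<close>
    define p where "p x = (g i x - v i x) + (1 - \<eta> x) * v i x" for x
    have p: "p \<in> X" "N p \<le> 2 * \<delta>"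
    proof -
      note vc = cut[OF vX k(2), of i]
      show "p \<in> X" unfolding p_def by (rule add[OF diff[OF gX vX] conjunct1[OF vc]])
      show "N p \<le> 2 * \<delta>"
        using norm_triangle[OF diff[OF gX[of i] vX[of i]] conjunct1[OF vc]] vc e(3)[of i]
        unfolding p_def by (simp add: v_def)
    qed
    have "w i = (\<lambda>x. p x - partial_deriv i \<eta> x * u x)"
      by (simp add: w_def[abs_def] p_def \<phi>' algebra_simps)
    moreover have "N (\<lambda>x. p x - partial_deriv i \<eta> x * u x) \<le> N p + N (\<lambda>x. partial_deriv i \<eta> x * u x)"
      using norm_triangle[OF p(1) scale[OF conjunct1[OF slope[of i]], of "- 1"]]
        norm_scale[OF conjunct1[OF slope[of i]], of "- 1"] by simp
    ultimately show ?thesis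
      using diff[OF p(1) conjunct1[OF slope[of i]]] p(2) slope[of i] by (simp add: distrib_right)
  qed
  have "has_weak_partial (\<lambda>x. f x - \<phi> x) i (w i)" for i
    unfolding w_def
    by (rule has_weak_partial_diff[OF fl fg continuous_imp_L1_loc[OF test_functionsD(3)[OF \<phi>]]
          test_function_has_weak_partial[OF \<phi>]])
  then have "sobolev_norm N (\<lambda>x. f x - \<phi> x) \<le> N (\<lambda>x. f x - \<phi> x) + (\<Sum>i\<in>UNIV. N (w i))"
    using wN by (intro sobolev_norm_le) auto
  also have "\<dots> \<le> 2 * \<delta> + real CARD('n) * ((2 + D) * \<delta>)"
    using wN by (intro add_mono N0 sum_bounded_above) auto
  also have "\<dots> < c * \<delta>"
    using \<delta> by (simp add: c_def algebra_simps)
  also have "\<dots> = \<epsilon>" using c by (simp add: \<delta>_def)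
  finally show ?thesis using \<phi> by blast
qed

end

theorem corollary1p4:
  fixes X :: "(real ^ 'n \<Rightarrow> real) set"
    and N :: "(real ^ 'n \<Rightarrow> real) \<Rightarrow> real"
  assumes "banach_function_space X N"
    and "fatou_property X N"
    and "absolutely_continuous_norm X N"
    and "strong_muckenhoupt X N"
  shows "test_functions \<subseteq> sobolev_space X \<and>
    (\<forall>f\<in>sobolev_space X. \<forall>\<epsilon>>0. \<exists>\<phi>\<in>test_functions. sobolev_norm N (\<lambda>x. f x - \<phi> x) < \<epsilon>)"
proof -
  interpret muckenhoupt_space X N
    using assms by (simp add: muckenhoupt_space_def muckenhoupt_space_axioms_def)
  show ?thesis
    using test_functions_subset_sobolev_space test_functions_dense by blast
qed

end
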